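(* Let $P$ be a biobjective combinatorial optimization problem. Then the variant of the Dichotomic Approach described in the context outputs the nondominated extreme points of $P$ with polynomial delay if the lexicographic version of $P$ is solvable in polynomial time.
   Context: A biobjective combinatorial optimization (BOCO) problem $P$ is a collection of instances $(\mathcal{S},C)$ with implicitly given solution set $\mathcal{S}\subseteq\{0,1\}^n$ and $C\in\mathbb{Q}^{2\times n}$ with rows $c_1,c_2$; the input size is $n+\langle C\rangle$, where $\langle\cdot\rangle$ is binary encoding length. The nondominated extreme points of an instance are the extreme points of the polyhedron $\{Cx\mid x\in\operatorname{conv}\mathcal{S}\}+\mathbb{R}^2_{\ge}$, where $\mathbb{R}^2_{\ge}$ is the set of vectors with nonnegative entries. The lexicographic version of $P$ is the problem: given an instance and $\ell\in\mathbb{Q}^2$, $\ell\ge0$, solve $$P^{\mathrm{Lex\text{-}WS}}(\ell):\ \operatorname{lexmin}\{(\ell^{T}Cx,\ c_1x,\ c_2x)\mid x\in\mathcal{S}\},$$ where lexmin is the minimum in the lexicographic order. "The point resulting from $P^{\mathrm{Lex\text{-}WS}}(\ell)$" means $Cx$ for an optimal $x$. The variant of the Dichotomic Approach (with access to an algorithm for the lexicographic version of $P$) uses a queue $\widetilde{\mathcal{Q}}$ of triples of points and the following check of a pair $(y^2,y^3)$ of nondominated extreme points: set $\lambda:=(|y^2_2-y^3_2|,\ |y^2_1-y^3_1|)$, so that $\lambda^{T}y^2=\lambda^{T}y^3$, and solve $P^{\mathrm{Lex\text{-}WS}}(\lambda)$, resulting in a nondominated extreme point $y$. If $y$ equals $y^2$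 or $y^3$, it is verified that there is no nondominated extreme point lexicographically between $y^2$ and $y^3$, and nothing is added; otherwise the triple $(y,y^2,y^3)$ is added to $\widetilde{\mathcal{Q}}$. 1. Compute the points $y^0$ and $y^1$ resulting from $P^{\mathrm{Lex\text{-}WS}}((1,0))$ and $P^{\mathrm{Lex\text{-}WS}}((0,1))$, and output them (once if they coincide). If $y^0=y^1$, terminate. Otherwise check the pair $(y^0,y^1)$. 2. While $\widetilde{\mathcal{Q}}$ is nonempty: retrieve a triple $(y,y^2,y^3)$ from $\widetilde{\mathcal{Q}}$, output $y$, and check the two pairs $(y,y^2)$ and $(y,y^3)$. 3. Terminate when $\widetilde{\mathcal{Q}}$ is empty. Thus in each iteration of step 2 exactly one point is output and at most two lexicographic weighted-sum problems are solved. The model of computation is the RAM with memory cells of polynomially bounded bit length. Polynomial delay means that the time before the first output, the time between any two consecutive outputs, and the time between the last output and termination are each bounded by a polynomial in the input size. Each nondominated extreme point is to be output exactly once. *)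

theory Defs
  imports
    "HOL-Analysis.Analysis"
    "HOL-Computational_Algebra.Polynomial"
    "HOL-Library.Log_Nat"
begin

section \<open>Encoding lengths\<close>

text \<open>Bit length of a rational number: a sign bit and the binary lengths of numerator and
  denominator in lowest terms (\<^term>\<open>bitlen k\<close> is \<open>\<lceil>log\<^sub>2 (k + 1)\<rceil>\<close> for \<open>k \<ge> 0\<close>).\<close>

definition bits :: "rat \<Rightarrow> nat" where
  "bits q = (case quotient_of q of (a, b) \<Rightarrow> 1 + nat (bitlen \<bar>a\<bar>) + nat (bitlen b))"

section \<open>Biobjective combinatorial optimization\<close>

text \<open>Vectors of \<open>\<rat>\<^sup>n\<close> and \<open>\<real>\<^sup>n\<close> are lists of length \<open>n\<close>, because \<open>n\<close> varies with the instance.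
  The solution set is given only implicitly: \<open>descr\<close> is whatever data (a graph, say) the
  instance supplies to algorithms in order to represent \<open>sols\<close>. It is unrestricted and, as it
  is not part of \<open>C\<close> or \<open>n\<close>, does not contribute to the input size.\<close>

record boco_instance =
  dim :: nat
  sols :: "rat list set"
  cost1 :: "rat list"
  cost2 :: "rat list"
  descr :: "rat list"

definition valid_instance :: "boco_instance \<Rightarrow> bool" where
  "valid_instance I \<longleftrightarrow>
     sols I \<subseteq> {x. length x = dim I \<and> set x \<subseteq> {0, 1}} \<and>
     length (cost1 I) = dim I \<and> length (cost2 I) = dim I"

definition boco_problem :: "boco_instance set \<Rightarrow> bool" where
  "boco_problem P \<longleftrightarrow> (\<forall>I\<in>P. valid_instance I)"

definition input_size :: "boco_instance \<Rightarrow> nat" where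
  "input_size I = dim I + sum_list (map bits (cost1 I)) + sum_list (map bits (cost2 I))"

definition obj1 :: "boco_instance \<Rightarrow> rat list \<Rightarrow> rat" where
  "obj1 I x = (\<Sum>j<dim I. cost1 I ! j * x ! j)"

definition obj2 :: "boco_instance \<Rightarrow> rat list \<Rightarrow> rat" where
  "obj2 I x = (\<Sum>j<dim I. cost2 I ! j * x ! j)"

text \<open>The convex hull in \<open>\<real>\<^sup>n\<close> of a finite set \<open>S \<subseteq> \<rat>\<^sup>n\<close>.\<close>

definition conv :: "nat \<Rightarrow> rat list set \<Rightarrow> real list set" where
  "conv n S = {map (\<lambda>j. \<Sum>x\<in>S. u x * of_rat (x ! j)) [0..<n] | u :: rat list \<Rightarrow> real.
     (\<forall>x\<in>S. 0 \<le> u x) \<and> (\<Sum>x\<in>S. u x) = 1}"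

definition upper_image :: "boco_instance \<Rightarrow> (real \<times> real) set" where
  "upper_image I =
     {(\<Sum>j<dim I. of_rat (cost1 I ! j) * z ! j, \<Sum>j<dim I. of_rat (cost2 I ! j) * z ! j) + r
      | z r. z \<in> conv (dim I) (sols I) \<and> 0 \<le> fst r \<and> 0 \<le> snd r}"

definition nondominated_extreme_points :: "boco_instance \<Rightarrow> (real \<times> real) set" where
  "nondominated_extreme_points I = {y. y extreme_point_of upper_image I}"

fun lex_le :: "rat \<times> rat \<times> rat \<Rightarrow> rat \<times> rat \<times> rat \<Rightarrow> bool" where
  "lex_le (a, b, c) (a', b', c') \<longleftrightarrow> a < a' \<or> a = a' \<and> (b < b' \<or> b = b' \<and> c \<le> c')"

definition lex_ws_value :: "boco_instance \<Rightarrow> rat \<times> rat \<Rightarrow> rat list \<Rightarrow> rat \<times> rat \<times> rat" where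
  "lex_ws_value I l x = (fst l * obj1 I x + snd l * obj2 I x, obj1 I x, obj2 I x)"

definition lex_ws_optimal :: "boco_instance \<Rightarrow> rat \<times> rat \<Rightarrow> rat list \<Rightarrow> bool" where
  "lex_ws_optimal I l x \<longleftrightarrow>
     x \<in> sols I \<and> (\<forall>x'\<in>sols I. lex_le (lex_ws_value I l x) (lex_ws_value I l x'))"

section \<open>The random access machine\<close>

text \<open>
  A RAM with structured control flow. Cells are numbered by natural numbers and hold rational
  numbers; every elementary operation takes one unit of time. The constructor arguments of type
  \<^typ>\<open>nat\<close> are cell numbers, except for the two block lengths noted below.

  \<^item> \<open>Load i j\<close> is \<open>M[i] := M[M[j]]\<close>, \<open>Store i j\<close> is \<open>M[M[i]] := M[j]\<close>, and \<open>Read i j\<close> is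
    \<open>M[i] := input[M[j]]\<close>, where the input is read-only.
  \<^item> \<open>Emit i k\<close> outputs the \<open>k\<close> cells from \<open>i\<close> on as one item.
  \<^item> \<open>Call c a k b l\<close> runs the subroutine \<open>c\<close> on the same input in a private memory, which holds
    a copy of the \<open>k\<close> cells from \<open>a\<close> on in its cells \<open>0, \<dots>, k - 1\<close> and is zero elsewhere. The first
    \<open>M[l]\<close> cells of the private memory are then copied to the cells from \<open>b\<close> on. The time
    of the subroutine and of copying is charged to the caller.
\<close>

datatype arith_op = Plus | Minus | Times | Divide

datatype test = Less nat nat | Equal nat nat | Conj test test | Disj test test

datatype com =
    Skip
  | Const nat rat
  | Copy nat nat
  | Arith nat arith_op nat nat
  | Floor nat nat
  | Load nat nat
  | Store nat nat
  | Read nat nat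
  | Emit nat nat
  | Seq com com  (infixr \<open>;;\<close> 60)
  | If test com com
  | While test com
  | Call com nat nat nat nat

type_synonym memory = "nat \<Rightarrow> rat"

text \<open>Memory, clock, and the items output so far with the times of their output.\<close>

type_synonym state = "memory \<times> nat \<times> (nat \<times> rat list) list"

fun arith :: "arith_op \<Rightarrow> rat \<Rightarrow> rat \<Rightarrow> rat" where
  "arith Plus x y = x + y"
| "arith Minus x y = x - y"
| "arith Times x y = x * y"
| "arith Divide x y = x / y"

fun holds :: "test \<Rightarrow> memory \<Rightarrow> bool" where
  "holds (Less i j) m \<longleftrightarrow> m i < m j"
| "holds (Equal i j) m \<longleftrightarrow> m i = m j"
| "holds (Conj a b) m \<longleftrightarrow> holds a m \<and> holds b m"
| "holds (Disj a b) m \<longleftrightarrow> holds a m \<or> holds b m"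

definition addr :: "rat \<Rightarrow> nat" where
  "addr q = nat \<lfloor>q\<rfloor>"

text \<open>\<open>exec w inp c s s'\<close>: on a machine whose cells have bit length \<open>w\<close>, the program \<open>c\<close> started
  in \<open>s\<close> on the input \<open>inp\<close> terminates in \<open>s'\<close>. An operation whose result does not fit into a cell
  cannot be executed, so that such a run has no final state.\<close>

inductive exec :: "nat \<Rightarrow> (nat \<Rightarrow> rat) \<Rightarrow> com \<Rightarrow> state \<Rightarrow> state \<Rightarrow> bool"
  for w :: nat and inp :: "nat \<Rightarrow> rat" where
  Skip: "exec w inp Skip (m, t, out) (m, t + 1, out)"
| Const: "bits q \<le> w \<Longrightarrow>
    exec w inp (Const i q) (m, t, out) (m(i := q), t + 1, out)"
| Copy: "exec w inp (Copy i j) (m, t, out) (m(i := m j), t + 1, out)"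
| Arith: "bits (arith f (m j) (m k)) \<le> w \<Longrightarrow>
    exec w inp (Arith i f j k) (m, t, out) (m(i := arith f (m j) (m k)), t + 1, out)"
| Floor: "bits (of_int \<lfloor>m j\<rfloor>) \<le> w \<Longrightarrow>
    exec w inp (Floor i j) (m, t, out) (m(i := of_int \<lfloor>m j\<rfloor>), t + 1, out)"
| Load: "exec w inp (Load i j) (m, t, out) (m(i := m (addr (m j))), t + 1, out)"
| Store: "exec w inp (Store i j) (m, t, out) (m(addr (m i) := m j), t + 1, out)"
| Read: "bits (inp (addr (m j))) \<le> w \<Longrightarrow>
    exec w inp (Read i j) (m, t, out) (m(i := inp (addr (m j))), t + 1, out)"
| Emit: "exec w inp (Emit i k) (m, t, out)
    (m, t + 1 + k, out @ [(t + 1 + k, map m [i..<i + k])])"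
| Seq: "exec w inp c s s' \<Longrightarrow> exec w inp d s' s'' \<Longrightarrow> exec w inp (c ;; d) s s''"
| IfTrue: "holds b m \<Longrightarrow> exec w inp c (m, t + 1, out) s' \<Longrightarrow>
    exec w inp (If b c d) (m, t, out) s'"
| IfFalse: "\<not> holds b m \<Longrightarrow> exec w inp d (m, t + 1, out) s' \<Longrightarrow>
    exec w inp (If b c d) (m, t, out) s'"
| WhileFalse: "\<not> holds b m \<Longrightarrow>
    exec w inp (While b c) (m, t, out) (m, t + 1, out)"
| WhileTrue: "holds b m \<Longrightarrow> exec w inp c (m, t + 1, out) s' \<Longrightarrow>
    exec w inp (While b c) s' s'' \<Longrightarrow> exec w inp (While b c) (m, t, out) s''"
| Call: "exec w inp c ((\<lambda>i. if i < k then m (a + i) else 0), 0, []) (m', t', out') \<Longrightarrow>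
    r = addr (m l) \<Longrightarrow>
    exec w inp (Call c a k b l) (m, t, out)
      ((\<lambda>i. if b \<le> i \<and> i < b + r then m' (i - b) else m i), t + 1 + k + r + t', out)"

section \<open>Polynomial time and polynomial delay\<close>

definition input_of :: "boco_instance \<Rightarrow> nat \<Rightarrow> rat" where
  "input_of I i =
     (let xs = of_nat (dim I) # cost1 I @ cost2 I @ descr I in if i < length xs then xs ! i else 0)"

text \<open>The weights are passed in cells 0 and 1. The result is a flag in cell 0, which tells whether
  the instance is feasible, followed by an optimal solution if it is.\<close>

definition solves_lex_in_poly_time :: "com \<Rightarrow> boco_instance set \<Rightarrow> bool" where
  "solves_lex_in_poly_time A P \<longleftrightarrow>
     (\<exists>(p :: nat poly) (q :: nat poly). \<forall>I\<in>P. \<forall>l1\<ge>0. \<forall>l2\<ge>0.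
        let N = input_size I + bits l1 + bits l2 in
        \<exists>m t out.
          exec (poly q N) (input_of I) A ((\<lambda>_. 0)(0 := l1, 1 := l2), 0, []) (m, t, out) \<and>
          t \<le> poly p N \<and>
          (if sols I = {} then m 0 = 0
           else m 0 = 1 \<and> lex_ws_optimal I (l1, l2) (map m [1..<dim I + 1])))"

text \<open>The times to be considered are the start, the outputs, and the termination at \<open>t\<close>.\<close>

definition delay_le :: "nat \<Rightarrow> (nat \<times> 'a) list \<Rightarrow> nat \<Rightarrow> bool" where
  "delay_le d out t \<longleftrightarrow>
     (let ts = 0 # map fst out @ [t] in \<forall>i \<le> length out. ts ! Suc i \<le> ts ! i + d)"

definition enumerates_with_poly_delay :: "com \<Rightarrow> boco_instance set \<Rightarrow> bool" where
  "enumerates_with_poly_delay D P \<longleftrightarrow>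
     (\<exists>(p :: nat poly) (q :: nat poly). \<forall>I\<in>P.
        \<exists>m t out ys.
          exec (poly q (input_size I)) (input_of I) D ((\<lambda>_. 0), 0, []) (m, t, out) \<and>
          map snd out = map (\<lambda>(y1, y2). [y1, y2]) ys \<and>
          distinct ys \<and>
          (\<lambda>(y1, y2). (of_rat y1, of_rat y2)) ` set ys = nondominated_extreme_points I \<and>
          delay_le (poly p (input_size I)) out t)"

section \<open>The variant of the Dichotomic Approach\<close>

text \<open>Cell numbers. A point occupies two consecutive cells. The answer of the subroutine is stored
  from \<open>FLAG\<close> on, i.e. the solution from \<open>FLAG + 1\<close> on, and the queue from \<open>FLAG + 1 + n\<close> on.\<close>

abbreviation (input) "ZERO \<equiv> 0 :: nat"
abbreviation (input) "ONE \<equiv> 1 :: nat"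
abbreviation (input) "N \<equiv> 2 :: nat"
abbreviation (input) "LEN \<equiv> 3 :: nat"
abbreviation (input) "L1 \<equiv> 4 :: nat"
abbreviation (input) "L2 \<equiv> 5 :: nat"
abbreviation (input) "Y1 \<equiv> 6 :: nat"
abbreviation (input) "Y2 \<equiv> 7 :: nat"
abbreviation (input) "J \<equiv> 8 :: nat"
abbreviation (input) "T \<equiv> 9 :: nat"
abbreviation (input) "B \<equiv> 10 :: nat"
abbreviation (input) "V \<equiv> 11 :: nat"
abbreviation (input) "XBASE \<equiv> 12 :: nat"
abbreviation (input) "HEAD \<equiv> 13 :: nat"
abbreviation (input) "TAIL \<equiv> 14 :: nat"
abbreviation (input) "P1 \<equiv> 15 :: nat"
abbreviation (input) "P2 \<equiv> 16 :: nat"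
abbreviation (input) "Q1 \<equiv> 17 :: nat"
abbreviation (input) "Q2 \<equiv> 18 :: nat"
abbreviation (input) "U1 \<equiv> 19 :: nat"
abbreviation (input) "U2 \<equiv> 20 :: nat"
abbreviation (input) "V1 \<equiv> 21 :: nat"
abbreviation (input) "V2 \<equiv> 22 :: nat"
abbreviation (input) "W1 \<equiv> 23 :: nat"
abbreviation (input) "W2 \<equiv> 24 :: nat"
abbreviation (input) "FLAG \<equiv> 25 :: nat"

text \<open>\<open>(Y1, Y2) := C x\<close> for the solution \<open>x\<close> returned by the subroutine.\<close>

definition compute_point :: com where
  "compute_point =
     Const Y1 0 ;; Const Y2 0 ;; Const J 0 ;;
     While (Less J N)
      (Arith T Plus XBASE J ;; Load B T ;;
       Arith T Plus ONE J ;; Read V T ;; Arith V Times V B ;; Arith Y1 Plus Y1 V ;;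
       Arith T Plus T N ;; Read V T ;; Arith V Times V B ;; Arith Y2 Plus Y2 V ;;
       Arith J Plus J ONE)"

definition solve_lex :: "com \<Rightarrow> com" where
  "solve_lex A = Call A L1 2 FLAG LEN"

definition enqueue :: "nat \<Rightarrow> com" where
  "enqueue i = Store TAIL i ;; Arith TAIL Plus TAIL ONE"

definition dequeue :: "nat \<Rightarrow> com" where
  "dequeue i = Load i HEAD ;; Arith HEAD Plus HEAD ONE"

definition absolute :: "nat \<Rightarrow> com" where
  "absolute i = If (Less i ZERO) (Arith i Minus ZERO i) Skip"

text \<open>The check of the pair of points \<open>(P1, P2)\<close>, \<open>(Q1, Q2)\<close>.\<close>

definition check_pair :: "com \<Rightarrow> com" where
  "check_pair A =
     Arith L1 Minus P2 Q2 ;; absolute L1 ;;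
     Arith L2 Minus P1 Q1 ;; absolute L2 ;;
     solve_lex A ;; compute_point ;;
     If (Disj (Conj (Equal Y1 P1) (Equal Y2 P2)) (Conj (Equal Y1 Q1) (Equal Y2 Q2)))
       Skip
      (enqueue Y1 ;; enqueue Y2 ;; enqueue P1 ;; enqueue P2 ;; enqueue Q1 ;; enqueue Q2)"

definition dichotomic_loop :: "com \<Rightarrow> com" where
  "dichotomic_loop A =
     While (Less HEAD TAIL)
      (dequeue U1 ;; dequeue U2 ;; dequeue V1 ;; dequeue V2 ;; dequeue W1 ;; dequeue W2 ;;
       Emit U1 2 ;;
       Copy P1 U1 ;; Copy P2 U2 ;; Copy Q1 V1 ;; Copy Q2 V2 ;; check_pair A ;;
       Copy P1 U1 ;; Copy P2 U2 ;; Copy Q1 W1 ;; Copy Q2 W2 ;; check_pair A)"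

text \<open>If the first call reports that the instance is infeasible, there is nothing to output.\<close>

definition dichotomic_approach :: "com \<Rightarrow> com" where
  "dichotomic_approach A =
     Const ZERO 0 ;; Const ONE 1 ;; Read N ZERO ;; Arith LEN Plus N ONE ;;
     Const XBASE 26 ;; Arith HEAD Plus XBASE N ;; Copy TAIL HEAD ;;
     Const L1 1 ;; Const L2 0 ;; solve_lex A ;;
     If (Equal FLAG ZERO)
       Skip
      (compute_point ;; Copy P1 Y1 ;; Copy P2 Y2 ;;
       Const L1 0 ;; Const L2 1 ;; solve_lex A ;;
       compute_point ;; Copy Q1 Y1 ;; Copy Q2 Y2 ;;
       Emit P1 2 ;;
       If (Conj (Equal P1 Q1) (Equal P2 Q2))
         Skip
        (Emit Q1 2 ;; check_pair A ;; dichotomic_loop A))"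

end

theory Submission
  imports Defs
begin

text \<open>
  The upper image is convex and closed under adding nonnegative vectors, and a lexicographic optimum
  for nonnegative weights is one of its extreme points. If two extreme points \<open>p\<close>, \<open>q\<close> have equal
  weighted sum \<open>\<lambda>\<close>, then an optimum for \<open>\<lambda>\<close> other than \<open>p\<close> and \<open>q\<close> lies strictly between them, while
  an optimum equal to \<open>p\<close> or \<open>q\<close> excludes every extreme point between them. Hence at each moment of
  the loop every extreme point either has been output once or lies inside exactly one queued pair,
  and each iteration outputs a new point after polynomially many steps.

  All objective values have a common denominator of at most \<open>2^S\<close> and absolute value at most \<open>2^S\<close>
  for the input size \<open>S\<close>, so the weights passed to the subroutine have \<open>O(S)\<close> bits. The queue may
  grow exponentially, but there are at most \<open>2^n\<close> solutions, so its addresses have \<open>O(n)\<close> bits.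
\<close>

section \<open>Bit lengths\<close>

text \<open>The lexicographic refinement secures extremality: a plain weighted sum may be minimal
  along a whole edge of the upper image, and an optimum inside that edge is not extreme, whereas the
  refined optimum is an end of the edge. Queueing triples secures the delay: with a queue of
  unchecked pairs, exponentially many iterations in a row could merely confirm that nothing lies
  between their points. A triple enters the queue only together with a point still to be output, so
  every iteration begins with an output, and an unsuccessful check costs no iteration of its own.
  The invariant is phrased as an equation between counts, because this one form gives distinctness,
  completeness and the freshness of each new output; freshness in turn bounds the number of
  iterations, and with it the addresses. Delays do not simply add up as running times do, so the
  induction over the loop also carries the time of the last output.\<close>

lemma bits_le:
  fixes q :: rat and D :: int
  assumes "D > 0" "D \<le> 2 ^ k" "q * of_int D \<in> \<int>" "\<bar>q\<bar> \<le> 2 ^ k"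
  shows "bits q \<le> 3 * k + 3"
proof -
  obtain a b where ab: "quotient_of q = (a, b)" by fastforce
  have b: "b > 0" and cop: "coprime a b" and q: "q = of_int a / of_int b"
    using quotient_of_denom_pos[OF ab] quotient_of_coprime[OF ab] quotient_of_div[OF ab] by auto
  obtain z where z: "q * of_int D = of_int z" using assms(3) by (auto elim: Ints_cases)
  have "q * of_int b = of_int a" using q b by simp
  then have "of_int (a * D) = (of_int (z * b) :: rat)"
    using z by (metis mult.assoc mult.commute of_int_mult)
  then have "a * D = z * b" by (simp only: of_int_eq_iff)
  \<comment> \<open>In lowest terms the denominator divides every integer that clears it.\<close>
  then have "b dvd D" using cop by (metis coprime_commute coprime_dvd_mult_right_iff dvd_triv_right)
  then have bD: "b \<le> 2 ^ k" using zdvd_imp_le assms(1,2) by fastforce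
  have "of_int \<bar>a\<bar> = \<bar>q\<bar> * of_int b" using q b by simp
  also have "\<dots> \<le> 2 ^ k * of_int b" using assms(4) b by (intro mult_right_mono) auto
  finally have "of_int \<bar>a\<bar> \<le> (of_int (2 ^ k * b) :: rat)" by simp
  then have "\<bar>a\<bar> \<le> 2 ^ k * b" by (simp only: of_int_le_iff)
  also have "\<dots> \<le> 2 ^ k * 2 ^ k" using bD by simp
  also have "\<dots> = 2 ^ (2 * k)" by (simp only: power_add mult_2)
  also have "\<dots> < (2::int) ^ (2 * k + 1)" by (rule power_strict_increasing) auto
  finally have "\<bar>a\<bar> < 2 ^ (2 * k + 1)" .
  then have "bitlen \<bar>a\<bar> \<le> int (2 * k + 1)" by (simp only: bitlen_le_iff_power nat_int) simp
  moreover have "bitlen b \<le> int (k + 1)"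
    using bD power_strict_increasing[of k "k + 1" "2::int"]
    by (simp only: bitlen_le_iff_power nat_int) linarith
  \<comment> \<open>One sign bit, \<open>2 * k + 1\<close> bits for the numerator and
    \<open>k + 1\<close> bits for the denominator.\<close>
  ultimately show ?thesis by (simp add: bits_def ab)
qed

lemma bits_of_nat_le:
  assumes "a < 2 ^ k"
  shows "bits (of_nat a) \<le> k + 2"
proof -
  have q: "quotient_of (rat_of_nat a) = (int a, 1)"
    using quotient_of_int[of "int a"] by simp
  have "bitlen (int a) \<le> int k" using assms by (simp add: less_power_nat_iff_bitlen)
  moreover have "bitlen 1 \<le> 1" by (simp add: bitlen_le_iff_power)
  ultimately show ?thesis by (simp add: bits_def q)
qed

lemma quotient_le_bits:
  assumes "quotient_of q = (a, b)"
  shows "b \<le> 2 ^ bits q" and "\<bar>q\<bar> \<le> 2 ^ bits q"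
proof -
  have b: "b > 0" and q: "q = of_int a / of_int b"
    using quotient_of_denom_pos[OF assms] quotient_of_div[OF assms] by auto
  have "b < 2 ^ nat (bitlen b)" using bitlen_bounds[OF b] by blast
  also have "(2::int) ^ nat (bitlen b) \<le> 2 ^ bits q"
    by (rule power_increasing) (auto simp: bits_def assms)
  finally show "b \<le> 2 ^ bits q" by simp
  have "\<bar>a\<bar> \<le> 2 ^ nat (bitlen \<bar>a\<bar>)"
    using bitlen_bounds[of "\<bar>a\<bar>"] by (cases "a = 0") auto
  also have "(2::int) ^ nat (bitlen \<bar>a\<bar>) \<le> 2 ^ bits q"
    by (rule power_increasing) (auto simp: bits_def assms)
  finally have "\<bar>a\<bar> \<le> 2 ^ bits q" .
  then have "of_int \<bar>a\<bar> \<le> (of_int (2 ^ bits q) :: rat)" by (simp only: of_int_le_iff)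
  then have "\<bar>of_int a\<bar> \<le> (2 ^ bits q :: rat)" by simp
  moreover have "\<bar>q\<bar> \<le> \<bar>of_int a\<bar>"
  proof -
    have "\<bar>of_int a :: rat\<bar> / of_int b \<le> \<bar>of_int a\<bar> / 1" by (rule divide_left_mono) (use b in auto)
    then show ?thesis using b by (simp add: q)
  qed
  ultimately show "\<bar>q\<bar> \<le> 2 ^ bits q" by simp
qed

text \<open>A product instead of the least common multiple: each factor is at most 2 to the length
  of its entry, so the lengths simply add up in the exponent.\<close>

definition common_denom :: "rat list \<Rightarrow> int" where
  "common_denom c = prod_list (map (snd \<circ> quotient_of) c)"

lemma common_denom_pos: "common_denom c > 0"
  by (induction c) (auto simp: common_denom_def quotient_of_denom_pos')

lemma common_denom_le: "common_denom c \<le> 2 ^ sum_list (map bits c)"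
proof (induction c)
  case (Cons a c)
  have "snd (quotient_of a) * common_denom c \<le> 2 ^ bits a * 2 ^ sum_list (map bits c)"
    using quotient_le_bits(1)[OF prod.collapse[symmetric]] Cons.IH common_denom_pos[of c]
    by (intro mult_mono) (auto simp: less_imp_le)
  then show ?case by (simp add: common_denom_def power_add)
qed (simp add: common_denom_def)

lemma times_common_denom_Ints: "q \<in> set c \<Longrightarrow> q * of_int (common_denom c) \<in> \<int>"
proof (induction c)
  case (Cons a c)
  have a: "a * of_int (snd (quotient_of a)) \<in> \<int>"
  proof -
    obtain x y where xy: "quotient_of a = (x, y)" by fastforce
    have "a * of_int y = of_int x"
      using quotient_of_div[OF xy] quotient_of_denom_pos[OF xy] by simp
    then show ?thesis by (simp add: xy)
  qed
  show ?case
  proof (cases "q = a")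
    case True
    have "q * of_int (common_denom (a # c)) = a * of_int (snd (quotient_of a)) * of_int (common_denom c)"
      by (simp add: common_denom_def True)
    then show ?thesis using a by (metis Ints_mult Ints_of_int)
  next
    case False
    have "q * of_int (common_denom (a # c)) = q * of_int (common_denom c) * of_int (snd (quotient_of a))"
      by (simp add: common_denom_def)
    then show ?thesis using Cons False by (metis Ints_mult Ints_of_int set_ConsD)
  qed
qed simp

text \<open>Prefixes of length \<open>m\<close> are treated, here and in
  \<open>subset_sum_abs_le\<close>, because the machine accumulates an objective value term by term
  and every intermediate sum has to fit into a cell.\<close>

lemma subset_sum_times_common_denom:
  assumes "m \<le> length c" "\<And>j. j < m \<Longrightarrow> x ! j \<in> {0, 1 :: rat}"
  shows "(\<Sum>j<m. c ! j * x ! j) * of_int (common_denom c) \<in> \<int>"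
  unfolding sum_distrib_right
proof (rule Ints_sum)
  fix j assume "j \<in> {..<m}"
  then have "c ! j \<in> set c" "x ! j \<in> \<int>" using assms(1) assms(2)[of j] by auto
  then have "c ! j * of_int (common_denom c) * x ! j \<in> \<int>"
    using times_common_denom_Ints Ints_mult by blast
  then show "c ! j * x ! j * of_int (common_denom c) \<in> \<int>" by (simp add: ac_simps)
qed

lemma subset_sum_abs_le:
  assumes "m \<le> length c" "\<And>j. j < m \<Longrightarrow> x ! j \<in> {0, 1 :: rat}"
  shows "\<bar>\<Sum>j<m. c ! j * x ! j\<bar> \<le> 2 ^ (length c + sum_list (map bits c))"
proof -
  have "\<bar>\<Sum>j<m. c ! j * x ! j\<bar> \<le> (\<Sum>j<m. \<bar>c ! j * x ! j\<bar>)" by (rule sum_abs)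
  also have "\<dots> \<le> (\<Sum>j<m. 2 ^ sum_list (map bits c))"
  proof (rule sum_mono)
    fix j assume j: "j \<in> {..<m}"
    then have "\<bar>c ! j * x ! j\<bar> \<le> \<bar>c ! j\<bar>" using assms(2)[of j] by auto
    also have "\<dots> \<le> 2 ^ bits (c ! j)" using quotient_le_bits(2) by (metis surj_pair)
    also have "\<dots> \<le> 2 ^ sum_list (map bits c)"
      using j assms(1) by (intro power_increasing member_le_sum_list) auto
    finally show "\<bar>c ! j * x ! j\<bar> \<le> 2 ^ sum_list (map bits c)" .
  qed
  \<comment> \<open>The crude bound \<open>2 ^ length c\<close> on the number of terms adds only
    \<open>length c\<close> to the exponent.\<close>
  also have "\<dots> \<le> of_nat (2 ^ length c) * 2 ^ sum_list (map bits c)"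
    using assms(1) less_exp[of "length c"] unfolding sum_constant card_lessThan
    by (intro mult_right_mono) (simp_all only: of_nat_le_iff, auto)
  finally show ?thesis by (simp add: power_add)
qed

section \<open>Extreme points of upward closed convex sets in the plane\<close>

text \<open>Comparing first coordinates is enough: among extreme points of an upward closed convex
  set they determine the point (\<open>extreme_fst_inj\<close>) and reverse the order of the second
  coordinates (\<open>extreme_snd_less\<close>). Symmetry in \<open>p\<close> and \<open>q\<close>
  spares an orientation of the queued pairs.\<close>

definition between :: "real \<times> real \<Rightarrow> real \<times> real \<Rightarrow> real \<times> real \<Rightarrow> bool" where
  "between p q e \<longleftrightarrow> fst p < fst e \<and> fst e < fst q \<or> fst q < fst e \<and> fst e < fst p"

definition weighted :: "real \<times> real \<Rightarrow> real \<times> real \<Rightarrow> real \<times> real \<Rightarrow> real" where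
  "weighted p q z = \<bar>snd p - snd q\<bar> * fst z + \<bar>fst p - fst q\<bar> * snd z"

lemma between_commute: "between p q e \<longleftrightarrow> between q p e"
  by (auto simp: between_def)

lemma weighted_commute: "weighted p q = weighted q p"
  by (auto simp: weighted_def abs_minus_commute)

locale upper_convex =
  fixes U :: "(real \<times> real) set"
  assumes convex: "convex U"
    and upward: "z \<in> U \<Longrightarrow> 0 \<le> a \<Longrightarrow> 0 \<le> b \<Longrightarrow> z + (a, b) \<in> U"
begin

text \<open>Otherwise \<open>e\<close> is the midpoint of \<open>s\<close> and its reflection
  \<open>s + 2 * (e - s)\<close>, which upward closure puts into \<open>U\<close>.\<close>

lemma extreme_le_eq:
  assumes e: "e extreme_point_of U" and s: "s \<in> U" "fst s \<le> fst e" "snd s \<le> snd e"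
  shows "s = e"
proof (rule ccontr)
  assume "s \<noteq> e"
  define b where "b = s + (2 * (fst e - fst s), 2 * (snd e - snd s))"
  have "b \<in> U" unfolding b_def using s by (intro upward) auto
  moreover have "e \<in> open_segment s b"
    using \<open>s \<noteq> e\<close> by (auto simp: in_segment b_def prod_eq_iff field_simps intro!: exI[of _ "1/2"])
  ultimately show False using e s by (auto simp: extreme_point_of_def)
qed

text \<open>The point of the chord at or directly below \<open>e\<close> equals \<open>e\<close> by
  \<open>extreme_le_eq\<close>, so \<open>e\<close> can only be an end of the chord, and
  \<open>t < 1\<close> makes it the end \<open>y\<close>.\<close>

lemma extreme_chord_eq:
  assumes e: "e extreme_point_of U" and "y \<in> U" "q \<in> U" and t: "0 \<le> t" "t < 1"
    and "fst e = (1 - t) * fst y + t * fst q" "(1 - t) * snd y + t * snd q \<le> snd e"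
  shows "e = y"
proof -
  define s where "s = (1 - t) *\<^sub>R y + t *\<^sub>R q"
  have "s \<in> U" unfolding s_def using convex assms by (intro convexD_alt) auto
  then have "s = e" using assms by (intro extreme_le_eq) (auto simp: s_def)
  then have "\<not> (y \<noteq> q \<and> 0 < t)"
    using assms by (fastforce simp: extreme_point_of_def in_segment s_def)
  then show ?thesis
  proof (cases "y = q")
    case True
    then have "s = y" unfolding s_def by (metis diff_add_cancel scaleR_left_distrib scaleR_one)
    then show ?thesis using \<open>s = e\<close> by simp
  next
    case False
    with \<open>\<not> (y \<noteq> q \<and> 0 < t)\<close> t have "t = 0" by simp
    then show ?thesis using \<open>s = e\<close> by (simp add: s_def)
  qed
qed

lemma extreme_fst_inj:
  assumes "e extreme_point_of U" "f extreme_point_of U" "fst e = fst f"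
  shows "e = f"
proof -
  have "e \<in> U" "f \<in> U" using assms by (simp_all add: extreme_point_of_def)
  then show ?thesis using assms extreme_le_eq by (metis linorder_linear order_refl)
qed

lemma extreme_snd_less:
  assumes "p extreme_point_of U" "q extreme_point_of U" "fst p < fst q"
  shows "snd q < snd p"
proof (rule ccontr)
  assume "\<not> snd q < snd p"
  moreover have "p \<in> U" using assms by (simp add: extreme_point_of_def)
  ultimately have "p = q" using assms by (intro extreme_le_eq) simp_all
  then show False using assms(3) by simp
qed

text \<open>The coordinate differences of two extreme points have opposite signs, so that with
  absolute values as weights the two contributions cancel.\<close>

lemma weighted_ends_eq:
  assumes "p extreme_point_of U" "q extreme_point_of U"
  shows "weighted p q p = weighted p q q"
proof (cases "fst p" "fst q" rule: linorder_cases)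
  case less
  then show ?thesis using extreme_snd_less[OF assms] by (simp add: weighted_def algebra_simps)
next
  case equal
  then show ?thesis using extreme_fst_inj[OF assms] by simp
next
  case greater
  then show ?thesis using extreme_snd_less[OF assms(2,1)] by (simp add: weighted_def algebra_simps)
qed

text \<open>Let \<open>p\<close> be the left end. If \<open>y\<close> were not to the right of
  \<open>p\<close>, then \<open>p\<close> would lie on or above the chord from \<open>y\<close> to
  \<open>q\<close>, because \<open>y\<close> is not above the line through \<open>p\<close> and
  \<open>q\<close>; \<open>extreme_chord_eq\<close> then forces \<open>y = p\<close>. The right end
  is treated in the same way.\<close>

lemma weighted_le_between:
  assumes "p extreme_point_of U" "q extreme_point_of U" "y \<in> U"
    and "weighted p q y \<le> weighted p q p" "p \<noteq> q" "y \<noteq> p" "y \<noteq> q"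
  shows "between p q y"
proof -
  have *: "between p q y" if less: "fst p < fst q" and
    asm: "p extreme_point_of U" "q extreme_point_of U" "weighted p q y \<le> weighted p q p"
      "y \<noteq> p" "y \<noteq> q" for p q
  proof -
    have U: "p \<in> U" "q \<in> U" using asm by (auto simp: extreme_point_of_def)
    have s: "snd q < snd p" using extreme_snd_less asm less by blast
    have v: "(snd p - snd q) * fst y + (fst q - fst p) * snd y
        \<le> (snd p - snd q) * fst p + (fst q - fst p) * snd p"
      using asm(3) less s by (simp add: weighted_def)
    have "fst p < fst y"
    proof (rule ccontr)
      assume n: "\<not> fst p < fst y"
      \<comment> \<open>The parameter at which the chord from \<open>y\<close> to \<open>q\<close>
        reaches the first coordinate of \<open>p\<close>.\<close>
      define t where "t = (fst p - fst y) / (fst q - fst y)"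
      have d: "fst q - fst y > 0" using n less by simp
      have t: "0 \<le> t" "t < 1" using d less n by (auto simp: t_def)
      have td: "t * (fst q - fst y) = fst p - fst y" using d by (simp add: t_def)
      have "(fst q - fst y) * ((1 - t) * snd y + t * snd q)
         = (fst q - fst y) * snd y + (t * (fst q - fst y)) * (snd q - snd y)"
        by (simp add: algebra_simps)
      also have "\<dots> \<le> (fst q - fst y) * snd p"
        using v unfolding td by (simp add: algebra_simps)
      finally have "(1 - t) * snd y + t * snd q \<le> snd p" using d by simp
      moreover have "fst p = (1 - t) * fst y + t * fst q" using td by (simp add: algebra_simps)
      ultimately have "p = y" using extreme_chord_eq[OF asm(1) assms(3) U(2) t] by blast
      then show False using asm by simp
    qed
    moreover have "fst y < fst q"
    proof (rule ccontr)
      assume n: "\<not> fst y < fst q"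
      define t where "t = (fst y - fst q) / (fst y - fst p)"
      have d: "fst y - fst p > 0" using n less by simp
      have t: "0 \<le> t" "t < 1" using d less n by (auto simp: t_def)
      have td: "t * (fst y - fst p) = fst y - fst q" using d by (simp add: t_def)
      have "(fst y - fst p) * ((1 - t) * snd y + t * snd p)
         = (fst y - fst p) * snd y + (t * (fst y - fst p)) * (snd p - snd y)"
        by (simp add: algebra_simps)
      also have "\<dots> \<le> (fst y - fst p) * snd q"
        using v unfolding td by (simp add: algebra_simps)
      finally have "(1 - t) * snd y + t * snd p \<le> snd q" using d by simp
      moreover have "fst q = (1 - t) * fst y + t * fst p" using td by (simp add: algebra_simps)
      ultimately have "q = y" using extreme_chord_eq[OF asm(2) assms(3) U(1) t] by blast
      then show False using asm by simp
    qed
    ultimately show ?thesis by (simp add: between_def)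
  qed
  show ?thesis
  proof (cases "fst p" "fst q" rule: linorder_cases)
    case less
    then show ?thesis using * assms by blast
  next
    case equal
    then show ?thesis using extreme_fst_inj assms by blast
  next
    case greater
    then have "between q p y"
      using *[of q p] assms weighted_ends_eq[of p q] by (simp add: weighted_commute[of q p])
    then show ?thesis by (simp add: between_commute)
  qed
qed

text \<open>A point strictly between \<open>p\<close> and \<open>q\<close> whose weighted sum is at
  least that of the ends lies on or above the chord from \<open>p\<close> to \<open>q\<close>. By
  \<open>extreme_chord_eq\<close>, an extreme point there would be an end.\<close>

lemma no_extreme_between:
  assumes "p extreme_point_of U" "q extreme_point_of U" "e extreme_point_of U"
    and "weighted p q p \<le> weighted p q e"
  shows "\<not> between p q e"
proof -
  have *: False if asm: "fst p < fst e" "fst e < fst q" "p extreme_point_of U"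
    "q extreme_point_of U" "weighted p q p \<le> weighted p q e" for p q
  proof -
    have U: "p \<in> U" "q \<in> U" using asm by (auto simp: extreme_point_of_def)
    have s: "snd q < snd p" using extreme_snd_less asm by fastforce
    have v: "(snd p - snd q) * fst p + (fst q - fst p) * snd p
        \<le> (snd p - snd q) * fst e + (fst q - fst p) * snd e"
      using asm s by (simp add: weighted_def)
    define t where "t = (fst e - fst p) / (fst q - fst p)"
    have d: "fst q - fst p > 0" using asm by simp
    have t: "0 \<le> t" "t < 1" using d asm by (auto simp: t_def)
    have td: "t * (fst q - fst p) = fst e - fst p" using d by (simp add: t_def)
    have "(fst q - fst p) * ((1 - t) * snd p + t * snd q)
        = (fst q - fst p) * snd p + (t * (fst q - fst p)) * (snd q - snd p)"
      by (simp add: algebra_simps)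
    also have "\<dots> \<le> (fst q - fst p) * snd e"
      using v unfolding td by (simp add: algebra_simps)
    finally have "(1 - t) * snd p + t * snd q \<le> snd e" using d by simp
    moreover have "fst e = (1 - t) * fst p + t * fst q" using td by (simp add: algebra_simps)
    ultimately have "e = p" using extreme_chord_eq[OF assms(3) U t] by blast
    then show False using asm by simp
  qed
  have "weighted q p q \<le> weighted q p e"
    using assms(4) weighted_ends_eq[OF assms(1,2)] by (simp add: weighted_commute[of q p])
  then show ?thesis
    unfolding between_def using *[of p q] *[of q p] assms by blast
qed

text \<open>Replacing a pair by the two pairs formed with \<open>y\<close> removes \<open>y\<close>
  from the count and nothing else: an extreme point with the first coordinate of \<open>y\<close> is
  \<open>y\<close>. The numeric form can be added directly to the counts of
  \<open>covered_step\<close>.\<close>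

lemma between_split:
  assumes "y extreme_point_of U" "e extreme_point_of U" "between p q y"
  shows "(if between p q e then 1 else 0) =
    (if e = y then 1 else 0) + (if between y p e then 1 else 0) + (if between y q e then 1 else (0::nat))"
  using assms extreme_fst_inj[of y e] by (auto simp: between_def)

end

text \<open>Unlike a half-plane, this set has \<open>(s, t)\<close> as an extreme point if \<open>v = a * s + b * t\<close>.\<close>

lemma convex_lex_ge:
  fixes a b v :: real
  shows "convex {z. v < a * fst z + b * snd z \<or> v = a * fst z + b * snd z \<and>
    (s < fst z \<or> s = fst z \<and> t \<le> snd z)}"
    (is "convex ?H")
proof (rule convexI)
  fix x y u w assume xy: "x \<in> ?H" "y \<in> ?H" and u: "0 \<le> u" "0 \<le> w" "u + w = (1::real)"
  define f where "f z = a * fst z + b * snd z" for z :: "real \<times> real"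
  have f: "f (u *\<^sub>R x + w *\<^sub>R y) = u * f x + w * f y" by (simp add: f_def algebra_simps)
  have comb: "c \<le> u * c1 + w * c2" "c < c1 \<or> c < c2 \<Longrightarrow> 0 < u \<Longrightarrow> 0 < w \<Longrightarrow> c < u * c1 + w * c2"
    if "c \<le> c1" "c \<le> c2" for c c1 c2
  proof -
    have c: "c = u * c + w * c" using u by (simp flip: distrib_right)
    have "u * c \<le> u * c1" "w * c \<le> w * c2" using that u by (auto intro: mult_left_mono)
    then show "c \<le> u * c1 + w * c2" using c by linarith
    assume "c < c1 \<or> c < c2" "0 < u" "0 < w"
    then have "u * c < u * c1 \<or> w * c < w * c2" by auto
    then show "c < u * c1 + w * c2" using c \<open>u * c \<le> _\<close> \<open>w * c \<le> _\<close> by linarith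
  qed
  have H: "z \<in> ?H \<longleftrightarrow> v < f z \<or> v = f z \<and> (s < fst z \<or> s = fst z \<and> t \<le> snd z)" for z
    by (simp add: f_def)
  \<comment> \<open>If both coefficients are positive, the first of the three criteria in which one
    of the points is strictly larger decides the comparison for the combination.\<close>
  consider "u = 0" "w = 1" | "w = 0" "u = 1" | "0 < u" "0 < w" using u by force
  then show "u *\<^sub>R x + w *\<^sub>R y \<in> ?H"
  proof cases
    case 3
    have vx: "v \<le> f x" "v \<le> f y" using xy unfolding H by auto
    show ?thesis
    proof (cases "v < f x \<or> v < f y")
      case True
      then show ?thesis unfolding H f using comb(2)[OF vx] 3 by blast
    next
      case False
      then have e: "f x = v" "f y = v" using vx by auto
      then have sx: "s \<le> fst x" "s \<le> fst y" using xy unfolding H by auto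
      have v: "u * f x + w * f y = v" using e u by (simp flip: distrib_right)
      show ?thesis
      proof (cases "s < fst x \<or> s < fst y")
        case True
        then show ?thesis unfolding H f v using comb(2)[OF sx] 3 by simp
      next
        case False
        then have s: "fst x = s" "fst y = s" using sx by auto
        then have "t \<le> snd x" "t \<le> snd y" using xy e unfolding H by auto
        moreover have "u * s + w * s = s" using u by (simp flip: distrib_right)
        ultimately show ?thesis unfolding H f v using comb(1)[of t "snd x" "snd y"] s by simp
      qed
    qed
  qed (use xy in simp_all)
qed

section \<open>The upper image\<close>

definition point :: "boco_instance \<Rightarrow> rat list \<Rightarrow> rat \<times> rat" where
  "point I x = (obj1 I x, obj2 I x)"

definition emb :: "rat \<times> rat \<Rightarrow> real \<times> real" where
  "emb y = (of_rat (fst y), of_rat (snd y))"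

lemma emb_eq_iff [simp]: "emb y = emb z \<longleftrightarrow> y = z"
  by (auto simp: emb_def prod_eq_iff)

text \<open>By linearity the costs map the hull of the solutions onto the hull of their planar
  points; from here on all geometry takes place in the plane.\<close>

lemma upper_image_eq:
  "upper_image I = {(\<Sum>x\<in>sols I. u x *\<^sub>R emb (point I x)) + (a, b) | u a b.
     (\<forall>x\<in>sols I. 0 \<le> u x) \<and> (\<Sum>x\<in>sols I. u x) = 1 \<and> 0 \<le> a \<and> 0 \<le> b}"
proof -
  have *: "(\<Sum>j<n. of_rat (c ! j) * map (\<lambda>j. \<Sum>x\<in>S. u x * of_rat (x ! j)) [0..<n] ! j)
      = (\<Sum>x\<in>S. u x * of_rat (\<Sum>j<n. c ! j * x ! j))" for n S c and u :: "rat list \<Rightarrow> real"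
  proof -
    have "(\<Sum>j<n. of_rat (c ! j) * map (\<lambda>j. \<Sum>x\<in>S. u x * of_rat (x ! j)) [0..<n] ! j)
      = (\<Sum>j<n. \<Sum>x\<in>S. of_rat (c ! j) * (u x * of_rat (x ! j)))"
      by (intro sum.cong) (auto simp: sum_distrib_left)
    also have "\<dots> = (\<Sum>x\<in>S. \<Sum>j<n. of_rat (c ! j) * (u x * of_rat (x ! j)))" by (rule sum.swap)
    also have "\<dots> = (\<Sum>x\<in>S. u x * of_rat (\<Sum>j<n. c ! j * x ! j))"
      by (intro sum.cong) (auto simp: of_rat_sum of_rat_mult sum_distrib_left ac_simps)
    finally show ?thesis .
  qed
  have **: "(\<Sum>x\<in>sols I. u x *\<^sub>R emb (point I x)) =
    (\<Sum>x\<in>sols I. u x * of_rat (obj1 I x), \<Sum>x\<in>sols I. u x * of_rat (obj2 I x))" for u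
    by (simp add: prod_eq_iff fst_sum snd_sum emb_def point_def)
  show ?thesis (is "_ = ?R")
  proof (intro equalityI subsetI)
    fix y assume "y \<in> upper_image I"
    then obtain u r where u: "\<forall>x\<in>sols I. 0 \<le> u x" "(\<Sum>x\<in>sols I. u x) = 1" "0 \<le> fst r" "0 \<le> snd r"
      and y: "y = (\<Sum>j<dim I. of_rat (cost1 I ! j) * map (\<lambda>j. \<Sum>x\<in>sols I. u x * of_rat (x ! j)) [0..<dim I] ! j,
        \<Sum>j<dim I. of_rat (cost2 I ! j) * map (\<lambda>j. \<Sum>x\<in>sols I. u x * of_rat (x ! j)) [0..<dim I] ! j) + r"
      unfolding upper_image_def conv_def by blast
    have "y = (\<Sum>x\<in>sols I. u x *\<^sub>R emb (point I x)) + (fst r, snd r)"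
      by (simp only: y * ** obj1_def obj2_def prod.collapse)
    then show "y \<in> ?R" using u by blast
  next
    fix y assume "y \<in> ?R"
    then obtain u a b where u: "\<forall>x\<in>sols I. 0 \<le> u x" "(\<Sum>x\<in>sols I. u x) = 1" "0 \<le> a" "0 \<le> b"
      and y: "y = (\<Sum>x\<in>sols I. u x *\<^sub>R emb (point I x)) + (a, b)"
      by blast
    show "y \<in> upper_image I"
      unfolding upper_image_def conv_def y ** obj1_def obj2_def mem_Collect_eq
      using u
      by (intro exI[of _ "map (\<lambda>j. \<Sum>x\<in>sols I. u x * of_rat (x ! j)) [0..<dim I]"]
          exI[of _ "(a, b)"] conjI exI[of _ u]) (simp_all only: * fst_conv snd_conv)
  qed
qed

lemma finite_sols: "valid_instance I \<Longrightarrow> finite (sols I)"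
  unfolding valid_instance_def
  by (rule finite_subset[OF _ finite_lists_length_eq[of "{0, 1}" "dim I"]]) auto

lemma card_sols_le:
  assumes "valid_instance I"
  shows "card (sols I) \<le> 2 ^ dim I"
proof -
  have "card (sols I) \<le> card {x. set x \<subseteq> {0, 1 :: rat} \<and> length x = dim I}"
    using assms unfolding valid_instance_def
    by (intro card_mono finite_lists_length_eq) auto
  then show ?thesis by (simp add: card_lists_length_eq numeral_2_eq_2)
qed

lemma upper_image_subset:
  assumes "valid_instance I" "convex H" "\<And>x. x \<in> sols I \<Longrightarrow> emb (point I x) \<in> H"
    and "\<And>z a b. z \<in> H \<Longrightarrow> 0 \<le> a \<Longrightarrow> 0 \<le> b \<Longrightarrow> z + (a, b) \<in> H"
  shows "upper_image I \<subseteq> H"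
proof
  fix y assume "y \<in> upper_image I"
  then obtain u a b where "\<forall>x\<in>sols I. 0 \<le> u x" "(\<Sum>x\<in>sols I. u x) = 1" "0 \<le> a" "0 \<le> b"
    and y: "y = (\<Sum>x\<in>sols I. u x *\<^sub>R emb (point I x)) + (a, b)"
    unfolding upper_image_eq by blast
  then show "y \<in> H"
    unfolding y using assms finite_sols by (intro assms(4) convex_sum) simp_all
qed

lemma emb_point_in_upper_image:
  assumes "valid_instance I" "x \<in> sols I"
  shows "emb (point I x) \<in> upper_image I"
proof -
  have "(\<Sum>x'\<in>sols I. (if x' = x then 1 else 0) *\<^sub>R emb (point I x')) = emb (point I x)"
    using finite_sols assms by (simp add: if_distrib[of "\<lambda>c. c *\<^sub>R _"] cong: if_cong)
  then show ?thesis unfolding upper_image_eq using finite_sols assms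
    by (intro CollectI exI[of _ "\<lambda>x'. if x' = x then 1 else 0"] exI[of _ 0])
      (auto simp: zero_prod_def[symmetric])
qed

lemma upper_convex_upper_image: "upper_convex (upper_image I)"
proof
  show "convex (upper_image I)"
  proof (rule convexI)
    fix p q s t assume "p \<in> upper_image I" "q \<in> upper_image I" and st: "0 \<le> s" "0 \<le> t" "s + t = (1::real)"
    then obtain u a b u' a' b' where
      p: "p = (\<Sum>x\<in>sols I. u x *\<^sub>R emb (point I x)) + (a, b)"
        "\<forall>x\<in>sols I. 0 \<le> u x" "(\<Sum>x\<in>sols I. u x) = 1" "0 \<le> a" "0 \<le> b" and
      q: "q = (\<Sum>x\<in>sols I. u' x *\<^sub>R emb (point I x)) + (a', b')"
        "\<forall>x\<in>sols I. 0 \<le> u' x" "(\<Sum>x\<in>sols I. u' x) = 1" "0 \<le> a'" "0 \<le> b'"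
      unfolding upper_image_eq by blast
    have "s *\<^sub>R p + t *\<^sub>R q = (\<Sum>x\<in>sols I. (s * u x + t * u' x) *\<^sub>R emb (point I x))
        + (s * a + t * a', s * b + t * b')"
      by (simp add: p(1) q(1) scaleR_right_distrib scaleR_left_distrib scaleR_sum_right sum.distrib)
    moreover have "(\<Sum>x\<in>sols I. s * u x + t * u' x) = 1"
      using p q st by (simp add: sum.distrib flip: sum_distrib_left)
    ultimately show "s *\<^sub>R p + t *\<^sub>R q \<in> upper_image I"
      unfolding upper_image_eq using p q st
      by (intro CollectI exI[of _ "\<lambda>x. s * u x + t * u' x"] exI[of _ "s * a + t * a'"]
          exI[of _ "s * b + t * b'"]) auto
  qed
  show "z + (a, b) \<in> upper_image I" if "z \<in> upper_image I" "0 \<le> a" "0 \<le> b" for z a b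
    using that unfolding upper_image_eq
    by (clarsimp simp: add.assoc) (metis add_nonneg_nonneg)
qed

text \<open>Optimality passes from the solutions to the whole upper image, because the points
  lexicographically not below the optimum form a convex set, and nonnegative weights make it upward
  closed.\<close>

lemma lex_ws_optimal_upper_image:
  assumes "valid_instance I" "lex_ws_optimal I (l1, l2) x" "0 \<le> l1" "0 \<le> l2" "z \<in> upper_image I"
  defines "v \<equiv> of_rat l1 * fst (emb (point I x)) + of_rat l2 * snd (emb (point I x))"
    and "f \<equiv> of_rat l1 * fst z + of_rat l2 * snd z"
  shows "v < f \<or> v = f \<and> (fst (emb (point I x)) < fst z \<or>
    fst (emb (point I x)) = fst z \<and> snd (emb (point I x)) \<le> snd z)"
proof -
  let ?H = "{z. v < of_rat l1 * fst z + of_rat l2 * snd z \<or> v = of_rat l1 * fst z + of_rat l2 * snd z \<and>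
    (fst (emb (point I x)) < fst z \<or> fst (emb (point I x)) = fst z \<and> snd (emb (point I x)) \<le> snd z)}"
  have "upper_image I \<subseteq> ?H"
  proof (rule upper_image_subset[OF assms(1) convex_lex_ge])
    fix x' assume "x' \<in> sols I"
    then have "lex_le (lex_ws_value I (l1, l2) x) (lex_ws_value I (l1, l2) x')"
      using assms(2) by (simp add: lex_ws_optimal_def)
    then show "emb (point I x') \<in> ?H"
      by (auto simp: v_def lex_ws_value_def emb_def point_def of_rat_less of_rat_less_eq
          simp flip: of_rat_mult of_rat_add)
  next
    fix z and a b :: real assume z: "z \<in> ?H" and ab: "0 \<le> a" "0 \<le> b"
    have "0 \<le> of_rat l1 * a" "0 \<le> of_rat l2 * b" using assms ab by auto
    then show "z + (a, b) \<in> ?H" using z ab by (auto simp: algebra_simps)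
  qed
  then show ?thesis using assms(5) unfolding f_def by blast
qed

text \<open>If the optimum were inside a segment, then weighted sum, first and second coordinate, in
  this order, would each be a proper average of two values not below it. So each agrees at both
  ends, and the segment collapses.\<close>

lemma lex_ws_optimal_extreme:
  assumes "valid_instance I" "lex_ws_optimal I (l1, l2) x" "0 \<le> l1" "0 \<le> l2"
  shows "emb (point I x) extreme_point_of upper_image I"
  unfolding extreme_point_of_def
proof (intro conjI ballI notI)
  show y: "emb (point I x) \<in> upper_image I"
    using assms by (intro emb_point_in_upper_image) (auto simp: lex_ws_optimal_def)
  fix a b assume ab: "a \<in> upper_image I" "b \<in> upper_image I" "emb (point I x) \<in> open_segment a b"
  define y where "y = emb (point I x)"
  obtain u where u: "a \<noteq> b" "0 < u" "u < 1" and yu: "y = (1 - u) *\<^sub>R a + u *\<^sub>R b"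
    using ab(3) by (auto simp: in_segment y_def)
  define f where "f z = of_rat l1 * fst z + of_rat l2 * snd z" for z :: "real \<times> real"
  have H: "f y < f z \<or> f y = f z \<and> (fst y < fst z \<or> fst y = fst z \<and> snd y \<le> snd z)"
    if "z \<in> upper_image I" for z
    using lex_ws_optimal_upper_image[OF assms that] by (simp add: f_def y_def)
  have eq: "c1 = c \<and> c2 = c" if "c = (1 - u) * c1 + u * c2" "c \<le> c1" "c \<le> c2" for c c1 c2
  proof -
    have "(1 - u) * (c1 - c) + u * (c2 - c) = 0" using that(1) by (simp add: algebra_simps)
    moreover have "0 \<le> (1 - u) * (c1 - c)" "0 \<le> u * (c2 - c)" using that u by auto
    ultimately have "(1 - u) * (c1 - c) = 0" "u * (c2 - c) = 0" by linarith+
    then show ?thesis using u by auto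
  qed
  have comb: "f y = (1 - u) * f a + u * f b" "fst y = (1 - u) * fst a + u * fst b"
    "snd y = (1 - u) * snd a + u * snd b"
    by (simp_all add: f_def yu algebra_simps)
  have Ha: "f y < f a \<or> f y = f a \<and> (fst y < fst a \<or> fst y = fst a \<and> snd y \<le> snd a)"
    and Hb: "f y < f b \<or> f y = f b \<and> (fst y < fst b \<or> fst y = fst b \<and> snd y \<le> snd b)"
    using H ab by blast+
  have fy: "f a = f y \<and> f b = f y" by (rule eq[OF comb(1)]) (use Ha Hb in linarith)+
  have fsty: "fst a = fst y \<and> fst b = fst y" by (rule eq[OF comb(2)]) (use Ha Hb fy in linarith)+
  have "snd a = snd y \<and> snd b = snd y" by (rule eq[OF comb(3)]) (use Ha Hb fy fsty in linarith)+
  with fsty show False using u by (simp add: prod_eq_iff)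
qed

section \<open>Weakest preconditions for the machine\<close>

text \<open>Existence of a final state asserts termination and that every result fits into a cell.
  Clock and output belong to the state, so time bounds are ordinary postconditions.\<close>

definition wp :: "nat \<Rightarrow> (nat \<Rightarrow> rat) \<Rightarrow> com \<Rightarrow> (state \<Rightarrow> bool) \<Rightarrow> state \<Rightarrow> bool" where
  "wp w inp c Q s \<longleftrightarrow> (\<exists>s'. exec w inp c s s' \<and> Q s')"

lemma wp_mono: "wp w inp c Q s \<Longrightarrow> (\<And>m t out. Q (m, t, out) \<Longrightarrow> R (m, t, out)) \<Longrightarrow> wp w inp c R s"
  unfolding wp_def by fast

inductive_simps exec_iff:
  "exec w inp Skip (m, t, out) s'"
  "exec w inp (Const i q) (m, t, out) s'"
  "exec w inp (Copy i j) (m, t, out) s'"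
  "exec w inp (Arith i f j k) (m, t, out) s'"
  "exec w inp (Load i j) (m, t, out) s'"
  "exec w inp (Store i j) (m, t, out) s'"
  "exec w inp (Read i j) (m, t, out) s'"
  "exec w inp (Emit i k) (m, t, out) s'"
  "exec w inp (c ;; d) s s'"
  "exec w inp (If b c d) (m, t, out) s'"

lemma wp_simps [simp]:
  "wp w inp Skip Q (m, t, out) \<longleftrightarrow> Q (m, t + 1, out)"
  "wp w inp (Const i q) Q (m, t, out) \<longleftrightarrow> bits q \<le> w \<and> Q (m(i := q), t + 1, out)"
  "wp w inp (Copy i j) Q (m, t, out) \<longleftrightarrow> Q (m(i := m j), t + 1, out)"
  "wp w inp (Arith i f j k) Q (m, t, out) \<longleftrightarrow>
    bits (arith f (m j) (m k)) \<le> w \<and> Q (m(i := arith f (m j) (m k)), t + 1, out)"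
  "wp w inp (Load i j) Q (m, t, out) \<longleftrightarrow> Q (m(i := m (addr (m j))), t + 1, out)"
  "wp w inp (Store i j) Q (m, t, out) \<longleftrightarrow> Q (m(addr (m i) := m j), t + 1, out)"
  "wp w inp (Read i j) Q (m, t, out) \<longleftrightarrow>
    bits (inp (addr (m j))) \<le> w \<and> Q (m(i := inp (addr (m j))), t + 1, out)"
  "wp w inp (Emit i k) Q (m, t, out) \<longleftrightarrow> Q (m, t + 1 + k, out @ [(t + 1 + k, map m [i..<i + k])])"
  "wp w inp (If b c d) Q (m, t, out) \<longleftrightarrow>
    (if holds b m then wp w inp c Q (m, t + 1, out) else wp w inp d Q (m, t + 1, out))"
  unfolding wp_def exec_iff by simp_all

text \<open>An equation between functions of the state, so that it also rewrites inside
  postconditions.\<close>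

lemma wp_Seq [simp]: "wp w inp (c ;; d) Q = wp w inp c (wp w inp d Q)"
  unfolding wp_def exec_iff by (rule ext) (simp, blast)

text \<open>A rule for a single unfolding; as a rewrite rule it would unfold forever.\<close>

lemma wp_While:
  "(if holds b m then wp w inp c (wp w inp (While b c) Q) (m, t + 1, out) else Q (m, t + 1, out)) \<Longrightarrow>
    wp w inp (While b c) Q (m, t, out)"
  unfolding wp_def by (cases "holds b m") (simp only: if_True if_False, blast intro: exec.WhileTrue exec.WhileFalse)+

text \<open>Normalizes the sums of single time units that accumulate in the clock during symbolic
  execution.\<close>

lemma Suc_collapse:
  "Suc (Suc a) = a + 2" "Suc (a + numeral k) = a + numeral (k + Num.One)"
  "a + numeral k + numeral l = a + numeral (k + l)"
  by simp_all

text \<open>The subroutine is only known to run with the cell length granted to it for its own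
  input; this transfers the run to the longer cells of the caller.\<close>

lemma exec_mono_word_length: "exec w inp c s s' \<Longrightarrow> w \<le> w' \<Longrightarrow> exec w' inp c s s'"
  by (induction rule: exec.induct) (blast intro: exec.intros order_trans)+

lemma addr_simps [simp]:
  "addr (of_nat k) = k"
  "addr 0 = 0"
  "addr (26 + of_nat j) = 26 + j"
  "addr (1 + of_nat j) = 1 + j"
  "addr (1 + of_nat j + of_nat k) = 1 + j + k"
proof -
  show *: "addr (of_nat k) = k" for k by (simp add: addr_def)
  show "addr 0 = 0" "addr (26 + of_nat j) = 26 + j" "addr (1 + of_nat j) = 1 + j"
    "addr (1 + of_nat j + of_nat k) = 1 + j + k"
    using *[of 0] *[of "26 + j"] *[of "1 + j"] *[of "1 + j + k"] by (simp_all add: add.assoc)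
qed

definition compute_step :: com where
  "compute_step =
     Arith T Plus XBASE J ;; Load B T ;;
     Arith T Plus ONE J ;; Read V T ;; Arith V Times V B ;; Arith Y1 Plus Y1 V ;;
     Arith T Plus T N ;; Read V T ;; Arith V Times V B ;; Arith Y2 Plus Y2 V ;;
     Arith J Plus J ONE"

section \<open>Runs of the dichotomic approach\<close>

text \<open>One fixed instance, with numbers \<open>w\<close> and \<open>d\<close> in place of the
  polynomials for cell length and time of a call. The bound \<open>3 * input_size I + 20\<close>
  generously covers the weights of a check (\<open>3 * input_size I + 6\<close> bits) and the
  addresses (\<open>n + 8\<close> bits).\<close>

locale dichotomic_run =
  fixes I :: boco_instance and A :: com and w d :: nat
  assumes valid: "valid_instance I"
    and word_length: "3 * input_size I + 20 \<le> w"
    and solver: "\<And>l1 l2. 0 \<le> l1 \<Longrightarrow> 0 \<le> l2 \<Longrightarrow>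
      bits l1 \<le> 3 * input_size I + 20 \<Longrightarrow> bits l2 \<le> 3 * input_size I + 20 \<Longrightarrow>
      \<exists>m t out. exec w (input_of I) A ((\<lambda>_. 0)(0 := l1, 1 := l2), 0, []) (m, t, out) \<and> t \<le> d \<and>
        (if sols I = {} then m 0 = 0
         else m 0 = 1 \<and> lex_ws_optimal I (l1, l2) (map m [1..<dim I + 1]))"
begin

abbreviation "n \<equiv> dim I"
abbreviation "run \<equiv> wp w (input_of I)"

section \<open>Bit lengths of the values and addresses that occur in a run\<close>

lemma length_cost [simp]: "length (cost1 I) = n" "length (cost2 I) = n"
  using valid by (auto simp: valid_instance_def)

lemma sols_binary: "x \<in> sols I \<Longrightarrow> length x = n \<and> (\<forall>j<n. x ! j \<in> {0, 1})"
proof -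
  assume "x \<in> sols I"
  then have "length x = n" "set x \<subseteq> {0, 1}" using valid by (auto simp: valid_instance_def)
  then show ?thesis by (metis nth_mem subset_iff)
qed

lemma input_of_simps:
  "input_of I 0 = of_nat n"
  "j < n \<Longrightarrow> input_of I (1 + j) = cost1 I ! j"
  "j < n \<Longrightarrow> input_of I (1 + j + n) = cost2 I ! j"
  by (simp_all add: input_of_def Let_def nth_append)

lemma dim_le_input_size: "n \<le> input_size I"
  and bits_cost1: "j < n \<Longrightarrow> bits (cost1 I ! j) \<le> w"
  and bits_cost2: "j < n \<Longrightarrow> bits (cost2 I ! j) \<le> w"
proof -
  show "n \<le> input_size I" by (simp add: input_size_def)
  assume j: "j < n"
  have "bits (cost1 I ! j) \<le> sum_list (map bits (cost1 I))"
    "bits (cost2 I ! j) \<le> sum_list (map bits (cost2 I))"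
    using j by (auto intro!: member_le_sum_list)
  then show "bits (cost1 I ! j) \<le> w" "bits (cost2 I ! j) \<le> w"
    using word_length by (auto simp: input_size_def)
qed

lemma bits_address: "a < 2 ^ (n + 6) \<Longrightarrow> bits (of_nat a) \<le> w"
  using bits_of_nat_le[of a "n + 6"] word_length dim_le_input_size by linarith

text \<open>Registers and flag take 26 cells, the solution takes \<open>n\<close>, which is at most
  \<open>2 ^ n\<close>, and each of at most \<open>2 ^ n\<close> outputs accounts for 12 queue
  cells. The total is at most \<open>39 * 2 ^ n\<close>, below \<open>64 * 2 ^ n\<close>.\<close>

lemma address_bound: "(a :: nat) \<le> 26 + 13 * 2 ^ n \<Longrightarrow> a < 2 ^ (n + 6)"
proof -
  assume a: "a \<le> 26 + 13 * 2 ^ n"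
  have "1 \<le> (2::nat) ^ n" "(2::nat) ^ (n + 6) = 64 * 2 ^ n" by (simp_all add: power_add)
  with a show ?thesis by linarith
qed

lemma bits_small: "a \<le> 26 + 2 * n \<Longrightarrow> bits (of_nat a) \<le> w"
  using less_exp[of n] by (intro bits_address address_bound) linarith

lemma bits_partial_sum:
  assumes "m \<le> n" "\<And>j. j < m \<Longrightarrow> x ! j \<in> {0, 1}"
  shows "bits (\<Sum>j<m. cost1 I ! j * x ! j) \<le> w" "bits (\<Sum>j<m. cost2 I ! j * x ! j) \<le> w"
proof -
  have "bits (\<Sum>j<m. c ! j * x ! j) \<le> 3 * input_size I + 3"
    if c: "length c = n" "n + sum_list (map bits c) \<le> input_size I" for c
  proof (rule bits_le[OF common_denom_pos])
    show "common_denom c \<le> 2 ^ input_size I"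
      using c(2) by (intro order_trans[OF common_denom_le] power_increasing) auto
    show "(\<Sum>j<m. c ! j * x ! j) * of_int (common_denom c) \<in> \<int>"
      using assms c by (intro subset_sum_times_common_denom) auto
    show "\<bar>\<Sum>j<m. c ! j * x ! j\<bar> \<le> 2 ^ input_size I"
      using assms c by (intro order_trans[OF subset_sum_abs_le] power_increasing) auto
  qed
  from this[of "cost1 I"] this[of "cost2 I"]
  show "bits (\<Sum>j<m. cost1 I ! j * x ! j) \<le> w" "bits (\<Sum>j<m. cost2 I ! j * x ! j) \<le> w"
    using word_length by (auto simp: input_size_def)
qed

text \<open>Two values of one objective share a common denominator, so their difference merely
  doubles the bound on the absolute value: \<open>bits_le\<close> applies with
  \<open>k = input_size I + 1\<close>.\<close>

lemma bits_objective_diff: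
  assumes "x \<in> sols I" "x' \<in> sols I"
  shows "bits (obj1 I x - obj1 I x') \<le> 3 * input_size I + 6"
    "bits (obj2 I x - obj2 I x') \<le> 3 * input_size I + 6"
proof -
  have "bits ((\<Sum>j<n. c ! j * x ! j) - (\<Sum>j<n. c ! j * x' ! j)) \<le> 3 * (input_size I + 1) + 3"
    if c: "length c = n" "n + sum_list (map bits c) \<le> input_size I" for c
  proof (rule bits_le[OF common_denom_pos])
    show "common_denom c \<le> 2 ^ (input_size I + 1)"
      using c(2) by (intro order_trans[OF common_denom_le] power_increasing) auto
    show "((\<Sum>j<n. c ! j * x ! j) - (\<Sum>j<n. c ! j * x' ! j)) * of_int (common_denom c) \<in> \<int>"
      unfolding left_diff_distrib
      using assms c sols_binary by (intro Ints_diff subset_sum_times_common_denom) auto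
    have *: "\<bar>\<Sum>j<n. c ! j * y ! j\<bar> \<le> 2 ^ input_size I" if "y \<in> sols I" for y
      using sols_binary[OF that] c by (intro order_trans[OF subset_sum_abs_le] power_increasing) auto
    then show "\<bar>(\<Sum>j<n. c ! j * x ! j) - (\<Sum>j<n. c ! j * x' ! j)\<bar> \<le> 2 ^ (input_size I + 1)"
      using *[OF assms(1)] *[OF assms(2)] by simp
  qed
  from this[of "cost1 I"] this[of "cost2 I"]
  show "bits (obj1 I x - obj1 I x') \<le> 3 * input_size I + 6"
    "bits (obj2 I x - obj2 I x') \<le> 3 * input_size I + 6"
    by (auto simp: obj1_def obj2_def input_size_def)
qed

section \<open>Evaluation of a solution and calls of the subroutine\<close>

definition constants :: "memory \<Rightarrow> bool" where
  "constants m \<longleftrightarrow> m 0 = 0 \<and> m 1 = 1 \<and> m 2 = of_nat n \<and> m 3 = of_nat n + 1 \<and> m 12 = 26"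

lemma constants_cong: "constants m \<Longrightarrow> (\<And>i. i < 4 \<or> i = 12 \<Longrightarrow> m' i = m i) \<Longrightarrow> constants m'"
  by (simp add: constants_def)

text \<open>Here and below, runs are described in continuation style: \<open>Q\<close> is arbitrary
  and is required only for the final states allowed by the time bound, the computed cells and the
  frame condition. Such lemmas can be chained along \<open>wp_Seq\<close>.\<close>

lemma run_compute_step:
  assumes m: "constants m" "j < n" "m 8 = of_nat j" "m (26 + j) = x ! j" "\<forall>i<n. x ! i \<in> {0, 1}"
    "m 6 = (\<Sum>i<j. cost1 I ! i * x ! i)" "m 7 = (\<Sum>i<j. cost2 I ! i * x ! i)"
    and Q: "\<And>m' t'. t' \<le> t + 11 \<Longrightarrow> m' 8 = of_nat (Suc j) \<Longrightarrow> m' 6 = (\<Sum>i<Suc j. cost1 I ! i * x ! i) \<Longrightarrow>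
      m' 7 = (\<Sum>i<Suc j. cost2 I ! i * x ! i) \<Longrightarrow> (\<forall>i. i < 6 \<or> 11 < i \<longrightarrow> m' i = m i) \<Longrightarrow>
      Q (m', t', out)"
  shows "run compute_step Q (m, t, out)"
proof -
  have b: "bits (26 + of_nat j) \<le> w" "bits (1 + of_nat j) \<le> w" "bits (of_nat j + 1) \<le> w"
    "bits (1 + of_nat j + of_nat n) \<le> w"
    using m(2) bits_small[of "26 + j"] bits_small[of "1 + j"] bits_small[of "1 + j + n"]
    by (simp_all add: ac_simps)
  have c: "bits (cost1 I ! j * x ! j) \<le> w" "bits (cost2 I ! j * x ! j) \<le> w"
    using m(2,5) bits_cost1[of j] bits_cost2[of j] bits_small[of 0] by auto
  have s: "bits ((\<Sum>i<j. cost1 I ! i * x ! i) + cost1 I ! j * x ! j) \<le> w"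
    "bits ((\<Sum>i<j. cost2 I ! i * x ! i) + cost2 I ! j * x ! j) \<le> w"
    using bits_partial_sum[of "Suc j" x] m(2,5) by simp_all
  show ?thesis
    unfolding compute_step_def
    using m b c s bits_cost1[OF m(2)] bits_cost2[OF m(2)] input_of_simps(2,3)[OF m(2)]
    by (auto simp: constants_def intro!: Q)
qed

text \<open>The start index \<open>j\<close> is arbitrary for the sake of induction. A pass costs 11
  operations and a test; one more test ends the loop.\<close>

lemma run_compute_loop:
  assumes "constants m" "j \<le> n" "m 8 = of_nat j" "\<forall>i<n. m (26 + i) = x ! i" "\<forall>i<n. x ! i \<in> {0, 1}"
    "m 6 = (\<Sum>i<j. cost1 I ! i * x ! i)" "m 7 = (\<Sum>i<j. cost2 I ! i * x ! i)"
    and Q: "\<And>m' t'. t' \<le> t + 12 * (n - j) + 1 \<Longrightarrow> m' 6 = obj1 I x \<Longrightarrow> m' 7 = obj2 I x \<Longrightarrow>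
      (\<forall>i. i < 6 \<or> 11 < i \<longrightarrow> m' i = m i) \<Longrightarrow> Q (m', t', out)"
  shows "run (While (Less J N) compute_step) Q (m, t, out)"
  using assms
proof (induction "n - j" arbitrary: j m t)
  case 0
  then have "j = n" by simp
  then show ?case
    using "0.prems" by (intro wp_While) (auto simp: constants_def obj1_def obj2_def)
next
  case (Suc k)
  then have j: "j < n" by simp
  have test: "holds (Less J N) m" using Suc.prems j by (simp add: constants_def)
  have "run compute_step (run (While (Less J N) compute_step) Q) (m, t + 1, out)"
  proof (rule run_compute_step[OF Suc.prems(1) j Suc.prems(3) _ Suc.prems(5-7)])
    show "m (26 + j) = x ! j" using Suc.prems(4) j by blast
    fix m' t' assume t': "t' \<le> t + 1 + 11" and m': "m' 8 = of_nat (Suc j)"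
      "m' 6 = (\<Sum>i<Suc j. cost1 I ! i * x ! i)" "m' 7 = (\<Sum>i<Suc j. cost2 I ! i * x ! i)"
      and frame: "\<forall>i. i < 6 \<or> 11 < i \<longrightarrow> m' i = m i"
    show "run (While (Less J N) compute_step) Q (m', t', out)"
    proof (rule Suc.hyps(1))
      show "constants m'" by (rule constants_cong[OF Suc.prems(1)]) (use frame in auto)
      show "\<forall>i<n. m' (26 + i) = x ! i" using Suc.prems(4) frame by simp
      fix m'' t'' assume "t'' \<le> t' + 12 * (n - Suc j) + 1" "m'' 6 = obj1 I x" "m'' 7 = obj2 I x"
        "\<forall>i. i < 6 \<or> 11 < i \<longrightarrow> m'' i = m' i"
      then show "Q (m'', t'', out)" using t' frame j by (intro Suc.prems(8)) simp_all
    qed (use Suc.hyps(2) Suc.prems m' j in simp_all)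
  qed
  then show ?case using test by (intro wp_While) simp
qed

lemma run_compute_point:
  assumes m: "constants m" "x \<in> sols I" "\<forall>i<n. m (26 + i) = x ! i"
    and Q: "\<And>m' t'. t' \<le> t + 12 * n + 4 \<Longrightarrow> m' 6 = obj1 I x \<Longrightarrow> m' 7 = obj2 I x \<Longrightarrow>
      (\<forall>i. i < 6 \<or> 11 < i \<longrightarrow> m' i = m i) \<Longrightarrow> Q (m', t', out)"
  shows "run compute_point Q (m, t, out)"
proof -
  have "run (While (Less J N) compute_step) Q (m(6 := 0, 7 := 0, 8 := 0), t + 3, out)"
  proof (rule run_compute_loop[where j = 0 and x = x])
    fix m' t' assume *: "t' \<le> t + 3 + 12 * (n - 0) + 1" "m' 6 = obj1 I x" "m' 7 = obj2 I x"
      "\<forall>i. i < 6 \<or> 11 < i \<longrightarrow> m' i = (m(6 := 0, 7 := 0, 8 := 0)) i"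
    then show "Q (m', t', out)" by (intro Q) auto
  qed (use m sols_binary in \<open>auto simp: constants_def\<close>)
  then show ?thesis
    unfolding compute_point_def compute_step_def
    using bits_small[of 0] by (simp add: Suc_collapse del: add_2_eq_Suc add_2_eq_Suc')
qed

text \<open>Nothing is known about the cells that \<open>A\<close> uses, but its private memory
  confines the effect to the answer block of \<open>n + 1\<close> cells from \<open>FLAG\<close> on,
  below the queue. Besides \<open>d\<close>, the time consists of 1 for the call, 2 for passing the
  weights and \<open>n + 1\<close> for copying back.\<close>

lemma run_solve_lex:
  assumes m: "constants m" "0 \<le> m 4" "0 \<le> m 5"
    "bits (m 4) \<le> 3 * input_size I + 20" "bits (m 5) \<le> 3 * input_size I + 20"
    and Q: "\<And>m' t'. t' \<le> t + n + 4 + d \<Longrightarrow> (\<forall>i. i < 25 \<or> 26 + n \<le> i \<longrightarrow> m' i = m i) \<Longrightarrow>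
      (if sols I = {} then m' 25 = 0
       else m' 25 = 1 \<and> lex_ws_optimal I (m 4, m 5) (map (\<lambda>i. m' (26 + i)) [0..<n])) \<Longrightarrow>
      Q (m', t', out)"
  shows "run (solve_lex A) Q (m, t, out)"
proof -
  obtain mA tA outA where
    ex: "exec w (input_of I) A ((\<lambda>_. 0)(0 := m 4, 1 := m 5), 0, []) (mA, tA, outA)" and
    tA: "tA \<le> d" and res: "if sols I = {} then mA 0 = 0
         else mA 0 = 1 \<and> lex_ws_optimal I (m 4, m 5) (map mA [1..<dim I + 1])"
    using solver[OF m(2-5)] by blast
  have arg: "(\<lambda>i. if i < 2 then m (4 + i) else 0) = (\<lambda>_. 0)(0 := m 4, 1 := m 5)"
    by (auto simp: fun_eq_iff less_2_cases_iff)
  have r: "addr (m 3) = n + 1"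
    using m(1) addr_simps(1)[of "n + 1"] by (simp add: constants_def add.commute)
  define m' where "m' = (\<lambda>i. if 25 \<le> i \<and> i < 25 + (n + 1) then mA (i - 25) else m i)"
  have "exec w (input_of I) (solve_lex A) (m, t, out) (m', t + 1 + 2 + (n + 1) + tA, out)"
    unfolding solve_lex_def m'_def
    by (rule exec.Call) (use ex arg r in simp_all)
  moreover have "Q (m', t + 1 + 2 + (n + 1) + tA, out)"
  proof (rule Q)
    have "map (\<lambda>i. m' (26 + i)) [0..<n] = map mA [1..<dim I + 1]"
      by (rule nth_equalityI) (simp_all add: m'_def del: upt_Suc)
    moreover have "m' 25 = mA 0" by (simp add: m'_def)
    ultimately show "if sols I = {} then m' 25 = 0
       else m' 25 = 1 \<and> lex_ws_optimal I (m 4, m 5) (map (\<lambda>i. m' (26 + i)) [0..<n])"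
      using res by (simp only:)
  qed (use tA in \<open>auto simp: m'_def\<close>)
  ultimately show ?thesis unfolding wp_def by blast
qed

lemma run_solve_point:
  assumes m: "constants m" "0 \<le> m 4" "0 \<le> m 5" "sols I \<noteq> {}"
    "bits (m 4) \<le> 3 * input_size I + 20" "bits (m 5) \<le> 3 * input_size I + 20"
    and Q: "\<And>m' t' x. t' \<le> t + 13 * n + 8 + d \<Longrightarrow> lex_ws_optimal I (m 4, m 5) x \<Longrightarrow>
      m' 6 = obj1 I x \<Longrightarrow> m' 7 = obj2 I x \<Longrightarrow>
      (\<forall>i. i < 6 \<or> 11 < i \<and> i < 25 \<or> 26 + n \<le> i \<longrightarrow> m' i = m i) \<Longrightarrow> Q (m', t', out)"
  shows "run (solve_lex A) (run compute_point Q) (m, t, out)"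
proof (rule run_solve_lex[OF m(1-3,5-6)])
  fix m' t' assume t': "t' \<le> t + n + 4 + d" and frame: "\<forall>i. i < 25 \<or> 26 + n \<le> i \<longrightarrow> m' i = m i"
    and "if sols I = {} then m' 25 = 0
       else m' 25 = 1 \<and> lex_ws_optimal I (m 4, m 5) (map (\<lambda>i. m' (26 + i)) [0..<n])"
  then have opt: "lex_ws_optimal I (m 4, m 5) (map (\<lambda>i. m' (26 + i)) [0..<n])"
    (is "lex_ws_optimal _ _ ?x") using m(4) by simp
  show "run compute_point Q (m', t', out)"
  proof (rule run_compute_point[where x = ?x])
    show "constants m'" by (rule constants_cong[OF m(1)]) (use frame in auto)
    show "?x \<in> sols I" using opt by (simp add: lex_ws_optimal_def)
    fix m'' t'' assume "t'' \<le> t' + 12 * n + 4" "m'' 6 = obj1 I ?x" "m'' 7 = obj2 I ?x"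
      "\<forall>i. i < 6 \<or> 11 < i \<longrightarrow> m'' i = m' i"
    then show "Q (m'', t'', out)" using t' frame by (intro Q[OF _ opt]) auto
  qed simp
qed

text \<open>Restricted to images of solutions, so that points stay rational, their bit lengths are
  bounded and their number is at most \<open>2 ^ n\<close>. That every extreme point arises in this
  way is not shown in advance; it comes out of \<open>covered_all\<close>.\<close>

definition ext :: "(rat \<times> rat) set" where
  "ext = {y \<in> point I ` sols I. emb y extreme_point_of upper_image I}"

lemma ext_optimal:
  assumes "lex_ws_optimal I (l1, l2) x" "0 \<le> l1" "0 \<le> l2"
  shows "point I x \<in> ext"
  using assms lex_ws_optimal_extreme[OF valid] by (auto simp: ext_def lex_ws_optimal_def)

lemma bits_ext_diff:
  assumes "p \<in> ext" "q \<in> ext"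
  shows "bits \<bar>fst p - fst q\<bar> \<le> 3 * input_size I + 6" "bits (fst p - fst q) \<le> 3 * input_size I + 6"
    "bits \<bar>snd p - snd q\<bar> \<le> 3 * input_size I + 6" "bits (snd p - snd q) \<le> 3 * input_size I + 6"
  using assms bits_objective_diff by (auto simp: ext_def point_def abs_if)

lemma run_absolute:
  assumes "m 0 = 0" "i \<noteq> 0" "bits \<bar>m i\<bar> \<le> w"
    and Q: "\<And>t'. t' \<le> t + 2 \<Longrightarrow> Q (m(i := \<bar>m i\<bar>), t', out)"
  shows "run (absolute i) Q (m, t, out)"
proof -
  have "m(i := m i) = m" by simp
  then show ?thesis
    unfolding absolute_def using assms(1-3) Q[of "t + 2"] by (auto simp: abs_if split: if_splits)
qed

section \<open>The queue of triples and the check of a pair\<close>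

type_synonym triple = "(rat \<times> rat) \<times> (rat \<times> rat) \<times> (rat \<times> rat)"

fun queue_at :: "memory \<Rightarrow> nat \<Rightarrow> triple list \<Rightarrow> bool" where
  "queue_at m h [] \<longleftrightarrow> True"
| "queue_at m h ((y, p, q) # ts) \<longleftrightarrow>
    m h = fst y \<and> m (h + 1) = snd y \<and> m (h + 2) = fst p \<and> m (h + 3) = snd p \<and>
    m (h + 4) = fst q \<and> m (h + 5) = snd q \<and> queue_at m (h + 6) ts"

lemma queue_at_append:
  "queue_at m h (ts @ ts') \<longleftrightarrow> queue_at m h ts \<and> queue_at m (h + 6 * length ts) ts'"
  by (induction m h ts rule: queue_at.induct) (auto simp: ac_simps)

lemma queue_at_cong:
  "queue_at m h ts \<Longrightarrow> (\<And>i. h \<le> i \<Longrightarrow> i < h + 6 * length ts \<Longrightarrow> m' i = m i) \<Longrightarrow> queue_at m' h ts"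
  by (induction m h ts rule: queue_at.induct) auto

text \<open>The point \<open>y\<close> has no special role here: until it is output, it is one of
  the extreme points between \<open>p\<close> and \<open>q\<close>.\<close>

fun inside :: "real \<times> real \<Rightarrow> triple \<Rightarrow> bool" where
  "inside e (y, p, q) \<longleftrightarrow> between (emb p) (emb q) e"

fun good :: "triple \<Rightarrow> bool" where
  "good (y, p, q) \<longleftrightarrow> y \<in> ext \<and> p \<in> ext \<and> q \<in> ext \<and> between (emb p) (emb q) (emb y)"

lemma of_rat_abs: "(of_rat \<bar>a\<bar> :: real) = \<bar>of_rat a\<bar>"
  by (simp add: abs_if of_rat_minus)

text \<open>These are the two outcomes of a check. The optimum minimizes \<open>weighted\<close>
  over the upper image. If it is an end, every extreme point weighs at least as much as the ends and
  \<open>no_extreme_between\<close> applies; otherwise it weighs at most as much as \<open>p\<close>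
  and \<open>weighted_le_between\<close> applies.\<close>

lemma optimal_between:
  assumes pq: "p \<in> ext" "q \<in> ext" "p \<noteq> q"
    and opt: "lex_ws_optimal I (\<bar>snd p - snd q\<bar>, \<bar>fst p - fst q\<bar>) x"
  shows "point I x = p \<or> point I x = q \<Longrightarrow> e extreme_point_of upper_image I \<Longrightarrow>
      \<not> between (emb p) (emb q) e"
    and "point I x \<noteq> p \<Longrightarrow> point I x \<noteq> q \<Longrightarrow> between (emb p) (emb q) (emb (point I x))"
proof -
  interpret upper_convex "upper_image I" by (rule upper_convex_upper_image)
  have E: "emb p extreme_point_of upper_image I" "emb q extreme_point_of upper_image I"
    using pq by (auto simp: ext_def)
  have y: "emb (point I x) extreme_point_of upper_image I"
    using ext_optimal[OF opt] by (simp add: ext_def)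
  have le: "weighted (emb p) (emb q) (emb (point I x)) \<le> weighted (emb p) (emb q) z"
    if "z \<in> upper_image I" for z
    using lex_ws_optimal_upper_image[OF valid opt _ _ that]
    by (auto simp: weighted_def emb_def of_rat_diff of_rat_abs)
  show "\<not> between (emb p) (emb q) e"
    if "point I x = p \<or> point I x = q" "e extreme_point_of upper_image I"
  proof (rule no_extreme_between[OF E that(2)])
    have "e \<in> upper_image I" using that(2) by (simp add: extreme_point_of_def)
    then show "weighted (emb p) (emb q) (emb p) \<le> weighted (emb p) (emb q) e"
      using le[of e] that(1) weighted_ends_eq[OF E] by auto
  qed
  show "between (emb p) (emb q) (emb (point I x))" if "point I x \<noteq> p" "point I x \<noteq> q"
    using that pq E y le by (intro weighted_le_between) (auto simp: extreme_point_of_def)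
qed

text \<open>The new address and clock are variables with defining equations, so that a chain of uses
  produces \<open>a + 2\<close>, \<open>a + 3\<close> and so on instead of nested sums.\<close>

lemma run_enqueue:
  assumes "m 14 = of_nat a" "m 1 = 1" "a + 1 < 2 ^ (n + 6)" "14 < a"
    and "b = a + 1" "t' = t + 2"
    and Q: "Q (m(a := m i, 14 := of_nat b), t', out)"
  shows "run (enqueue i) Q (m, t, out)"
  unfolding enqueue_def using assms bits_address[of "a + 1"] by (simp add: add.commute)

lemma run_dequeue:
  assumes "m 13 = of_nat h" "m 1 = 1" "h + 1 < 2 ^ (n + 6)" "i \<noteq> 1" "i \<noteq> 13"
    and "k = h + 1" "t' = t + 2"
    and Q: "Q (m(i := m h, 13 := of_nat k), t', out)"
  shows "run (dequeue i) Q (m, t, out)"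
  unfolding dequeue_def using assms bits_address[of "h + 1"] by (simp add: add.commute)

text \<open>The 27 consists of 6 for the weights, 8 for call and evaluation, 1 for the test and 12
  for six enqueued cells.\<close>

definition "check_time = d + 13 * n + 27"

text \<open>Both outcomes share one description: a list \<open>ts\<close> of at most one new triple
  whose count is 1 exactly for the extreme points between \<open>p\<close> and \<open>q\<close>. If
  nothing is enqueued, there are no such points.\<close>

lemma run_check_pair:
  assumes m: "constants m" "(m 15, m 16) = p" "(m 17, m 18) = q" "m 14 = of_nat a" "26 + n \<le> a"
    "a + 6 < 2 ^ (n + 6)"
    and pq: "p \<in> ext" "q \<in> ext" "p \<noteq> q"
    and Q: "\<And>m' t' ts. t' \<le> t + check_time \<Longrightarrow>
      (\<forall>i. i < 4 \<or> i = 12 \<or> i = 13 \<or> 15 \<le> i \<and> i < 25 \<or> 26 + n \<le> i \<and> i < a \<longrightarrow> m' i = m i) \<Longrightarrow>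
      length ts \<le> 1 \<Longrightarrow> m' 14 = of_nat (a + 6 * length ts) \<Longrightarrow> queue_at m' a ts \<Longrightarrow>
      \<forall>T\<in>set ts. good T \<Longrightarrow>
      (\<forall>e. e extreme_point_of upper_image I \<longrightarrow>
        length (filter (inside e) ts) = (if between (emb p) (emb q) e then 1 else 0)) \<Longrightarrow>
      Q (m', t', out)"
  shows "run (check_pair A) Q (m, t, out)"
proof -
  note c = m(1)[unfolded constants_def]
  have p: "m 15 = fst p" "m 16 = snd p" and q: "m 17 = fst q" "m 18 = snd q"
    using m(2,3) by auto
  have bits: "bits (fst p - fst q) \<le> w" "bits (snd p - snd q) \<le> w"
    "bits \<bar>fst p - fst q\<bar> \<le> w" "bits \<bar>snd p - snd q\<bar> \<le> w"
    using bits_ext_diff[OF pq(1,2)] word_length by auto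
  let ?test = "If (Disj (Conj (Equal Y1 P1) (Equal Y2 P2)) (Conj (Equal Y1 Q1) (Equal Y2 Q2)))
       Skip
      (enqueue Y1 ;; enqueue Y2 ;; enqueue P1 ;; enqueue P2 ;; enqueue Q1 ;; enqueue Q2)"
  \<comment> \<open>Each weight takes at most three units: a subtraction, a test, and a negation or
    \<open>Skip\<close>.\<close>
  have solve: "run (solve_lex A) (run compute_point (run ?test Q))
      (m(4 := \<bar>snd p - snd q\<bar>, 5 := \<bar>fst p - fst q\<bar>), t', out)" if t': "t' \<le> t + 6" for t'
  proof (rule run_solve_point)
    show "constants (m(4 := \<bar>snd p - snd q\<bar>, 5 := \<bar>fst p - fst q\<bar>))"
      by (rule constants_cong[OF m(1)]) auto
    show "sols I \<noteq> {}" using pq(1) by (auto simp: ext_def)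
    fix m' t'' x
    assume t'': "t'' \<le> t' + 13 * n + 8 + d" and y: "m' 6 = obj1 I x" "m' 7 = obj2 I x"
      and "lex_ws_optimal I ((m(4 := \<bar>snd p - snd q\<bar>, 5 := \<bar>fst p - fst q\<bar>)) 4,
        (m(4 := \<bar>snd p - snd q\<bar>, 5 := \<bar>fst p - fst q\<bar>)) 5) x"
      and fr: "\<forall>i. i < 6 \<or> 11 < i \<and> i < 25 \<or> 26 + n \<le> i \<longrightarrow>
        m' i = (m(4 := \<bar>snd p - snd q\<bar>, 5 := \<bar>fst p - fst q\<bar>)) i"
    then have opt: "lex_ws_optimal I (\<bar>snd p - snd q\<bar>, \<bar>fst p - fst q\<bar>) x" by simp
    have frame: "m' i = m i" if "i < 4 \<or> 11 < i \<and> i < 25 \<or> 26 + n \<le> i" for i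
      using fr[rule_format, of i] that by auto
    have y': "m' 6 = fst (point I x)" "m' 7 = snd (point I x)" using y by (simp_all add: point_def)
    note regs = frame[of 1, simplified] frame[of 14, simplified] frame[of 15, simplified]
      frame[of 16, simplified] frame[of 17, simplified] frame[of 18, simplified]
    show "run ?test Q (m', t'', out)"
    proof (cases "point I x = p \<or> point I x = q")
      case True
      have "Q (m', t'' + 2, out)"
      proof (rule Q[where ts = "[]"])
        show "\<forall>i. i < 4 \<or> i = 12 \<or> i = 13 \<or> 15 \<le> i \<and> i < 25 \<or> 26 + n \<le> i \<and> i < a \<longrightarrow> m' i = m i"
          using frame by auto
      qed (use True t' t'' frame optimal_between(1)[OF pq opt True] m(4) in \<open>auto simp: check_time_def\<close>)
      then show ?thesis using True by (auto simp: y' regs p q prod_eq_iff)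
    next
      case False
      let ?y = "point I x"
      define m2 where "m2 = m'(a := m' 6, 14 := of_nat (a + 1), a + 1 := m' 7, 14 := of_nat (a + 2),
        a + 2 := m' 15, 14 := of_nat (a + 3), a + 3 := m' 16, 14 := of_nat (a + 4),
        a + 4 := m' 17, 14 := of_nat (a + 5), a + 5 := m' 18, 14 := of_nat (a + 6))"
      have nums: "26 \<le> a" "a + 6 < 2 ^ (n + 6)" "m' 1 = 1" "m' 14 = of_nat a"
        using m(4-6) c regs by auto
      have Qm2: "Q (m2, t'' + 13, out)"
      proof (rule Q[where ts = "[(?y, p, q)]"])
        show "\<forall>i. i < 4 \<or> i = 12 \<or> i = 13 \<or> 15 \<le> i \<and> i < 25 \<or> 26 + n \<le> i \<and> i < a \<longrightarrow> m2 i = m i"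
          using frame m(5) by (auto simp: m2_def)
        show "t'' + 13 \<le> t + check_time" using t' t'' by (simp add: check_time_def)
        show "queue_at m2 a [(?y, p, q)]" using m(5) by (simp add: m2_def y' regs p q)
        show "\<forall>T\<in>set [(?y, p, q)]. good T"
          using optimal_between(2)[OF pq opt] False pq ext_optimal[OF opt] by simp
      qed (simp_all add: m2_def)
      have "run (enqueue Y1 ;; enqueue Y2 ;; enqueue P1 ;; enqueue P2 ;; enqueue Q1 ;; enqueue Q2)
          Q (m', t'' + 1, out)"
        unfolding wp_Seq
        apply (rule run_enqueue[where a = "a" and b = "a + 1" and t' = "t'' + 3"], (use nums in \<open>simp; fail\<close>)+)
        apply (rule run_enqueue[where a = "a + 1" and b = "a + 2" and t' = "t'' + 5"], (use nums in \<open>simp; fail\<close>)+)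
        apply (rule run_enqueue[where a = "a + 2" and b = "a + 3" and t' = "t'' + 7"], (use nums in \<open>simp; fail\<close>)+)
        apply (rule run_enqueue[where a = "a + 3" and b = "a + 4" and t' = "t'' + 9"], (use nums in \<open>simp; fail\<close>)+)
        apply (rule run_enqueue[where a = "a + 4" and b = "a + 5" and t' = "t'' + 11"], (use nums in \<open>simp; fail\<close>)+)
        apply (rule run_enqueue[where a = "a + 5" and b = "a + 6" and t' = "t'' + 13"], (use nums in \<open>simp; fail\<close>)+)
        by (use Qm2 nums in \<open>simp add: m2_def\<close>)
      then show ?thesis using False by (auto simp: y' regs p q prod_eq_iff)
    qed
  qed (use word_length bits_ext_diff[OF pq(1,2)] in auto)
  have abs2: "run (absolute L2) (run (solve_lex A) (run compute_point (run ?test Q)))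
      (m(4 := \<bar>snd p - snd q\<bar>, 5 := fst p - fst q), t' + 1, out)" if "t' \<le> t + 3" for t'
    using c bits that by (intro run_absolute) (auto intro!: solve)
  have "run (absolute L1) (run (Arith L2 Minus P1 Q1 ;; absolute L2 ;; solve_lex A ;; compute_point ;; ?test) Q)
      (m(4 := snd p - snd q), t + 1, out)"
    using c bits abs2 by (intro run_absolute) (auto simp: p q)
  then show ?thesis unfolding check_pair_def using bits by (simp add: p q)
qed

section \<open>The loop: account of the extreme points and time since the last output\<close>

definition "loop_time = 2 * check_time + 50"

text \<open>The output points \<open>ys\<close> and the queue \<open>ts\<close> account for every extreme point exactly once.\<close>

definition covered :: "(rat \<times> rat) list \<Rightarrow> triple list \<Rightarrow> bool" where
  "covered ys ts \<longleftrightarrow> set ys \<subseteq> ext \<and> (\<forall>T\<in>set ts. good T) \<and>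
    (\<forall>e. e extreme_point_of upper_image I \<longrightarrow>
      count_list (map emb ys) e + length (filter (inside e) ts) = 1)"

lemma covered_count:
  "covered ys ts \<Longrightarrow> e extreme_point_of upper_image I \<Longrightarrow>
    count_list (map emb ys) e + length (filter (inside e) ts) = 1"
  unfolding covered_def by blast

lemma covered_distinct:
  assumes "covered ys ts"
  shows "distinct ys"
proof -
  have "distinct (map emb ys)"
  proof (rule ccontr)
    assume "\<not> distinct (map emb ys)"
    then obtain xs zs us e where "map emb ys = xs @ [e] @ zs @ [e] @ us"
      using not_distinct_decomp by blast
    then have e: "e \<in> set (map emb ys)" "count_list (map emb ys) e \<ge> 2" by auto
    then have "e extreme_point_of upper_image I" using assms by (auto simp: covered_def ext_def)
    then have "count_list (map emb ys) e + length (filter (inside e) ts) = 1"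
      by (rule covered_count[OF assms])
    with e(2) show False by linarith
  qed
  then show ?thesis by (simp add: distinct_map)
qed

lemma length_le_if_distinct_ext:
  assumes "distinct ys" "set ys \<subseteq> ext"
  shows "length ys \<le> 2 ^ n"
proof -
  have "length ys = card (set ys)" using assms by (simp add: distinct_card)
  also have "\<dots> \<le> card (point I ` sols I)"
    using assms finite_sols[OF valid] by (intro card_mono) (auto simp: ext_def)
  also have "\<dots> \<le> 2 ^ n"
    using card_image_le[OF finite_sols[OF valid]] card_sols_le[OF valid] by (rule order_trans)
  finally show ?thesis .
qed

text \<open>The point \<open>y\<close> lies inside its own pair, which already exhausts its count of
  1.\<close>

lemma covered_fresh:
  assumes "covered ys ((y, p, q) # ts)"
  shows "y \<notin> set ys"
proof -
  have "emb y extreme_point_of upper_image I" "between (emb p) (emb q) (emb y)"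
    using assms by (auto simp: covered_def ext_def)
  moreover have "count_list (map emb ys) (emb y) + length (filter (inside (emb y)) ((y, p, q) # ts)) = 1"
    by (rule covered_count[OF assms calculation(1)])
  ultimately have "count_list (map emb ys) (emb y) = 0" by simp
  then show ?thesis by (auto simp: count_list_0_iff)
qed

lemma covered_all:
  assumes "covered ys []"
  shows "emb ` set ys = nondominated_extreme_points I"
proof
  show "emb ` set ys \<subseteq> nondominated_extreme_points I"
    using assms by (auto simp: covered_def ext_def nondominated_extreme_points_def)
  show "nondominated_extreme_points I \<subseteq> emb ` set ys"
  proof
    fix e assume "e \<in> nondominated_extreme_points I"
    then have "count_list (map emb ys) e = 1"
      using covered_count[OF assms, of e] by (simp add: nondominated_extreme_points_def)
    then have "e \<in> set (map emb ys)" by (metis count_notin zero_neq_one)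
    then show "e \<in> emb ` set ys" by simp
  qed
qed

text \<open>The contribution of the retrieved pair is redistributed by \<open>between_split\<close>
  to the output \<open>y\<close> and the two new pairs, so each total remains 1.\<close>

lemma covered_step:
  assumes "covered ys ((y, p, q) # ts)"
    and "\<forall>T\<in>set (us @ vs). good T"
    and "\<forall>e. e extreme_point_of upper_image I \<longrightarrow>
      length (filter (inside e) us) = (if between (emb y) (emb p) e then 1 else 0)"
    and "\<forall>e. e extreme_point_of upper_image I \<longrightarrow>
      length (filter (inside e) vs) = (if between (emb y) (emb q) e then 1 else 0)"
  shows "covered (ys @ [y]) (ts @ us @ vs)"
  unfolding covered_def
proof (intro conjI allI impI)
  interpret upper_convex "upper_image I" by (rule upper_convex_upper_image)
  have y: "y \<in> ext" "between (emb p) (emb q) (emb y)" using assms(1) by (auto simp: covered_def)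
  show "set (ys @ [y]) \<subseteq> ext" "\<forall>T\<in>set (ts @ us @ vs). good T"
    using assms(1,2) y by (auto simp: covered_def)
  fix e assume e: "e extreme_point_of upper_image I"
  have "count_list (map emb ys) e + length (filter (inside e) ((y, p, q) # ts)) = 1"
    by (rule covered_count[OF assms(1) e])
  moreover have "emb y extreme_point_of upper_image I" using y by (simp add: ext_def)
  note split = between_split[OF this e y(2)]
  have "length (filter (inside e) ((y, p, q) # ts)) = (if between (emb p) (emb q) e then 1 else 0)
      + length (filter (inside e) ts)"
    by simp
  moreover have "count_list (map emb (ys @ [y])) e = count_list (map emb ys) e + (if e = emb y then 1 else 0)"
    by simp
  ultimately show "count_list (map emb (ys @ [y])) e + length (filter (inside e) (ts @ us @ vs)) = 1"
    using assms(3)[rule_format, OF e] assms(4)[rule_format, OF e] split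
    unfolding filter_append length_append by linarith
qed

lemma run_dequeue_triple:
  assumes "m 13 = of_nat h" "m 1 = 1" "h + 6 < 2 ^ (n + 6)" "26 \<le> h" "queue_at m h ((y, p, q) # ts)"
    and Q: "\<And>m'. (\<forall>i. i \<noteq> 13 \<and> \<not> (19 \<le> i \<and> i \<le> 24) \<longrightarrow> m' i = m i) \<Longrightarrow> m' 13 = of_nat (h + 6) \<Longrightarrow>
      (m' 19, m' 20) = y \<Longrightarrow> (m' 21, m' 22) = p \<Longrightarrow> (m' 23, m' 24) = q \<Longrightarrow> Q (m', t + 12, out)"
  shows "run (dequeue U1 ;; dequeue U2 ;; dequeue V1 ;; dequeue V2 ;; dequeue W1 ;; dequeue W2) Q
    (m, t, out)"
proof -
  define m' where "m' = m(19 := m h, 13 := of_nat (h + 1), 20 := m (h + 1), 13 := of_nat (h + 2),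
    21 := m (h + 2), 13 := of_nat (h + 3), 22 := m (h + 3), 13 := of_nat (h + 4),
    23 := m (h + 4), 13 := of_nat (h + 5), 24 := m (h + 5), 13 := of_nat (h + 6))"
  have Qm': "Q (m', t + 12, out)"
    by (rule Q) (use assms(5) in \<open>auto simp: m'_def\<close>)
  note nums = assms(1-4)
  show ?thesis
    unfolding wp_Seq
    apply (rule run_dequeue[where h = "h" and k = "h + 1" and t' = "t + 2"], (use nums in \<open>simp; fail\<close>)+)
    apply (rule run_dequeue[where h = "h + 1" and k = "h + 2" and t' = "t + 4"], (use nums in \<open>simp; fail\<close>)+)
    apply (rule run_dequeue[where h = "h + 2" and k = "h + 3" and t' = "t + 6"], (use nums in \<open>simp; fail\<close>)+)
    apply (rule run_dequeue[where h = "h + 3" and k = "h + 4" and t' = "t + 8"], (use nums in \<open>simp; fail\<close>)+)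
    apply (rule run_dequeue[where h = "h + 4" and k = "h + 5" and t' = "t + 10"], (use nums in \<open>simp; fail\<close>)+)
    apply (rule run_dequeue[where h = "h + 5" and k = "h + 6" and t' = "t + 12"], (use nums in \<open>simp; fail\<close>)+)
    by (use Qm' nums in \<open>simp add: m'_def\<close>)
qed

text \<open>The 23 consists of 12 for dequeuing, 3 for the output and 4 for each of two blocks of
  copies. The output time is given exactly, since it is where the next delay starts. Room for 12
  cells allows both checks to enqueue a triple.\<close>

lemma run_loop_body:
  assumes m: "constants m" "m 13 = of_nat h" "m 14 = of_nat a" "26 + n \<le> h" "h + 6 \<le> a"
    "a + 12 < 2 ^ (n + 6)" "queue_at m h ((y, p, q) # ts)" "a = h + 6 + 6 * length ts"
    and yp: "y \<in> ext" "p \<in> ext" "q \<in> ext" "y \<noteq> p" "y \<noteq> q"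
    and Q: "\<And>m' t' us vs. t' \<le> t + 23 + 2 * check_time \<Longrightarrow> constants m' \<Longrightarrow> m' 13 = of_nat (h + 6) \<Longrightarrow>
      m' 14 = of_nat (h + 6 + 6 * length (ts @ us @ vs)) \<Longrightarrow> length us \<le> 1 \<Longrightarrow> length vs \<le> 1 \<Longrightarrow>
      queue_at m' (h + 6) (ts @ us @ vs) \<Longrightarrow> \<forall>T\<in>set (us @ vs). good T \<Longrightarrow>
      (\<forall>e. e extreme_point_of upper_image I \<longrightarrow>
        length (filter (inside e) us) = (if between (emb y) (emb p) e then 1 else 0)) \<Longrightarrow>
      (\<forall>e. e extreme_point_of upper_image I \<longrightarrow>
        length (filter (inside e) vs) = (if between (emb y) (emb q) e then 1 else 0)) \<Longrightarrow>
      Q (m', t', out @ [(t + 15, [fst y, snd y])])"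
  shows "run (dequeue U1 ;; dequeue U2 ;; dequeue V1 ;; dequeue V2 ;; dequeue W1 ;; dequeue W2 ;;
       Emit U1 2 ;;
       Copy P1 U1 ;; Copy P2 U2 ;; Copy Q1 V1 ;; Copy Q2 V2 ;; check_pair A ;;
       Copy P1 U1 ;; Copy P2 U2 ;; Copy Q1 W1 ;; Copy Q2 W2 ;; check_pair A) Q (m, t, out)"
proof -
  let ?out = "out @ [(t + 15, [fst y, snd y])]"
  let ?R = "Emit U1 2 ;;
       Copy P1 U1 ;; Copy P2 U2 ;; Copy Q1 V1 ;; Copy Q2 V2 ;; check_pair A ;;
       Copy P1 U1 ;; Copy P2 U2 ;; Copy Q1 W1 ;; Copy Q2 W2 ;; check_pair A"
  have "run (dequeue U1 ;; dequeue U2 ;; dequeue V1 ;; dequeue V2 ;; dequeue W1 ;; dequeue W2)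
      (run ?R Q) (m, t, out)"
  proof (rule run_dequeue_triple[OF m(2) _ _ _ m(7)])
    show "m 1 = 1" "h + 6 < 2 ^ (n + 6)" "26 \<le> h" using m by (auto simp: constants_def)
    fix m1 assume f1: "\<forall>i. i \<noteq> 13 \<and> \<not> (19 \<le> i \<and> i \<le> 24) \<longrightarrow> m1 i = m i"
      and m1: "m1 13 = of_nat (h + 6)" "(m1 19, m1 20) = y" "(m1 21, m1 22) = p" "(m1 23, m1 24) = q"
    have r1: "m1 19 = fst y" "m1 20 = snd y" "m1 21 = fst p" "m1 22 = snd p" "m1 23 = fst q" "m1 24 = snd q"
      using m1 by auto
    define m2 where "m2 = m1(15 := fst y, 16 := snd y, 17 := fst p, 18 := snd p)"
    have c2: "constants m2" by (rule constants_cong[OF m(1)]) (auto simp: m2_def f1)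
    have a2: "m2 14 = of_nat a" using f1 m(3) by (simp add: m2_def)
    have "run (check_pair A) (run (Copy P1 U1 ;; Copy P2 U2 ;; Copy Q1 W1 ;; Copy Q2 W2 ;; check_pair A) Q)
       (m2, t + 19, ?out)"
    proof (rule run_check_pair[OF c2 _ _ a2 _ _ yp(1,2,4)])
      show "(m2 15, m2 16) = y" "(m2 17, m2 18) = p" by (auto simp: m2_def)
      show "26 + n \<le> a" "a + 6 < 2 ^ (n + 6)" using m by auto
      fix m3 t3 us assume t3: "t3 \<le> t + 19 + check_time"
        and f3: "\<forall>i. i < 4 \<or> i = 12 \<or> i = 13 \<or> 15 \<le> i \<and> i < 25 \<or> 26 + n \<le> i \<and> i < a \<longrightarrow> m3 i = m2 i"
        and us: "length us \<le> 1" "m3 14 = of_nat (a + 6 * length us)" "queue_at m3 a us"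
          "\<forall>T\<in>set us. good T" "\<forall>e. e extreme_point_of upper_image I \<longrightarrow>
            length (filter (inside e) us) = (if between (emb y) (emb p) e then 1 else 0)"
      have r3: "m3 19 = fst y" "m3 20 = snd y" "m3 23 = fst q" "m3 24 = snd q"
        using f3 r1 by (simp_all add: m2_def)
      define m4 where "m4 = m3(15 := fst y, 16 := snd y, 17 := fst q, 18 := snd q)"
      have c4: "constants m4" by (rule constants_cong[OF c2]) (auto simp: m4_def f3)
      have a4: "m4 14 = of_nat (a + 6 * length us)" using us(2) by (simp add: m4_def)
      have "run (check_pair A) Q (m4, t3 + 4, ?out)"
      proof (rule run_check_pair[OF c4 _ _ a4 _ _ yp(1,3,5)])
        show "(m4 15, m4 16) = y" "(m4 17, m4 18) = q" by (auto simp: m4_def)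
        show "26 + n \<le> a + 6 * length us" "a + 6 * length us + 6 < 2 ^ (n + 6)" using m us(1) by auto
        fix m5 t5 vs assume t5: "t5 \<le> t3 + 4 + check_time"
          and f5: "\<forall>i. i < 4 \<or> i = 12 \<or> i = 13 \<or> 15 \<le> i \<and> i < 25 \<or>
            26 + n \<le> i \<and> i < a + 6 * length us \<longrightarrow> m5 i = m4 i"
          and vs: "length vs \<le> 1" "m5 14 = of_nat (a + 6 * length us + 6 * length vs)"
            "queue_at m5 (a + 6 * length us) vs"
            "\<forall>T\<in>set vs. good T" "\<forall>e. e extreme_point_of upper_image I \<longrightarrow>
              length (filter (inside e) vs) = (if between (emb y) (emb q) e then 1 else 0)"
        show "Q (m5, t5, ?out)"
        proof (rule Q[OF _ _ _ _ us(1) vs(1) _ _ us(5) vs(5)])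
          show "constants m5" by (rule constants_cong[OF c4]) (auto simp: f5)
          show "t5 \<le> t + 23 + 2 * check_time" using t3 t5 by simp
          show "m5 13 = of_nat (h + 6)" using m1(1) f3 f5 by (simp add: m2_def m4_def)
          show "m5 14 = of_nat (h + 6 + 6 * length (ts @ us @ vs))"
            using vs(2) m(8) by (simp add: algebra_simps)
          show "\<forall>T\<in>set (us @ vs). good T" using us(4) vs(4) by auto
          \<comment> \<open>Within the queue, each check writes only from its current tail on: the
            waiting triples survive both checks, and the triple of the first check survives the
            second.\<close>
          have "queue_at m5 (h + 6) ts"
          proof (rule queue_at_cong)
            show "queue_at m (h + 6) ts" using m(7) by simp
            fix i assume "h + 6 \<le> i" "i < h + 6 + 6 * length ts"
            then have i: "26 + n \<le> i" "i < a" using m by auto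
            then show "m5 i = m i" using f1 f3 f5 by (simp add: m2_def m4_def)
          qed
          moreover have "queue_at m5 a us"
          proof (rule queue_at_cong[OF us(3)])
            fix i assume "a \<le> i" "i < a + 6 * length us"
            then show "m5 i = m3 i" using m f5 by (simp add: m4_def)
          qed
          ultimately show "queue_at m5 (h + 6) (ts @ us @ vs)"
            using vs(3) by (simp add: queue_at_append m(8)[symmetric])
        qed
      qed
      then show "run (Copy P1 U1 ;; Copy P2 U2 ;; Copy Q1 W1 ;; Copy Q2 W2 ;; check_pair A) Q (m3, t3, ?out)"
        using r3 by (simp add: m4_def Suc_collapse del: add_2_eq_Suc add_2_eq_Suc')
    qed
    moreover have "map m1 [19..<21] = [fst y, snd y]" using r1 by (simp add: upt_rec)
    ultimately show "run ?R Q (m1, t + 12, out)"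
      using r1 by (simp add: m2_def Suc_collapse del: add_2_eq_Suc add_2_eq_Suc')
  qed
  then show ?thesis by simp
qed

text \<open>Here \<open>s\<close> is the time of the last output. An iteration enqueues at most two triples of six cells,
  so that the queue ends at most \<open>12\<close> cells per output beyond its initial position.\<close>

lemma run_loop:
  assumes "constants m" "m 13 = of_nat h" "m 14 = of_nat (h + 6 * length ts)" "26 + n \<le> h"
    "h + 6 * length ts \<le> 26 + n + 12 * length ys" "queue_at m h ts" "covered ys ts"
    "t \<le> s + loop_time"
  shows "run (dichotomic_loop A) (\<lambda>(m', t', out'). \<exists>os zs. out' = out @ os \<and>
    map snd os = map (\<lambda>(a, b). [a, b]) zs \<and> distinct (ys @ zs) \<and>
    emb ` set (ys @ zs) = nondominated_extreme_points I \<and>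
    successively (\<lambda>a b. b \<le> a + (loop_time + 50)) (s # map fst os @ [t'])) (m, t, out)"
  using assms
proof (induction "2 ^ n - length ys" arbitrary: m h ts ys t s out rule: less_induct)
  case less
  note c = less.prems(1)[unfolded constants_def]
  show ?case
  proof (cases ts)
    case Nil
    then have "\<not> holds (Less HEAD TAIL) m" using less.prems by simp
    then show ?thesis
      unfolding dichotomic_loop_def using Nil less.prems(7,8) covered_distinct covered_all
      by (intro wp_While) (auto intro!: exI[of _ "[]"] simp del: set_append)
  next
    case (Cons T0 ts')
    obtain y p q where T: "T0 = (y, p, q)" by (cases T0)
    have good: "y \<in> ext" "p \<in> ext" "q \<in> ext" "y \<noteq> p" "y \<noteq> q"
      using less.prems(7) unfolding Cons T by (auto simp: covered_def between_def)
    have "distinct (ys @ [y])" "set (ys @ [y]) \<subseteq> ext"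
      using covered_distinct[OF less.prems(7)] covered_fresh[of ys y p q ts'] less.prems(7) good(1)
      unfolding Cons T by (auto simp: covered_def)
    \<comment> \<open>The point about to be output still counts among at most \<open>2 ^ n\<close>
      points. Hence the measure decreases, and the 12 cells that the iteration may append stay
      within the address range.\<close>
    then have short: "length ys + 1 \<le> 2 ^ n" using length_le_if_distinct_ext by fastforce
    define a where "a = h + 6 + 6 * length ts'"
    have a: "a \<le> 26 + n + 12 * length ys" using less.prems(5) by (simp add: a_def Cons)
    then have a12: "a + 12 < 2 ^ (n + 6)" using short less_exp[of n] by (intro address_bound) linarith
    let ?post = "\<lambda>s out ys (m', t', out'). \<exists>os zs. out' = out @ os \<and>
      map snd os = map (\<lambda>(a, b). [a, b]) zs \<and> distinct (ys @ zs) \<and>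
      emb ` set (ys @ zs) = nondominated_extreme_points I \<and>
      successively (\<lambda>a b. b \<le> a + (loop_time + 50)) (s # map fst os @ [t'])"
    have test: "holds (Less HEAD TAIL) m" using less.prems(2,3) by (simp add: Cons)
    show ?thesis
      unfolding dichotomic_loop_def
    proof (rule wp_While, simp only: test if_True, fold dichotomic_loop_def,
        rule run_loop_body[OF less.prems(1,2) _ less.prems(4) _ a12 _ a_def good])
      show "m 14 = of_nat a" using less.prems(3) by (simp add: a_def Cons algebra_simps)
      show "queue_at m h ((y, p, q) # ts')" using less.prems(6) by (simp add: Cons T)
      show "h + 6 \<le> a" by (simp add: a_def)
      fix m' t' us vs
      assume t': "t' \<le> t + 1 + 23 + 2 * check_time" and m': "constants m'" "m' 13 = of_nat (h + 6)"
        "m' 14 = of_nat (h + 6 + 6 * length (ts' @ us @ vs))" "length us \<le> 1" "length vs \<le> 1"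
        "queue_at m' (h + 6) (ts' @ us @ vs)" "\<forall>T\<in>set (us @ vs). good T"
        "\<forall>e. e extreme_point_of upper_image I \<longrightarrow>
          length (filter (inside e) us) = (if between (emb y) (emb p) e then 1 else 0)"
        "\<forall>e. e extreme_point_of upper_image I \<longrightarrow>
          length (filter (inside e) vs) = (if between (emb y) (emb q) e then 1 else 0)"
      let ?out = "out @ [(t + 1 + 15, [fst y, snd y])]"
      have "run (dichotomic_loop A) (?post (t + 1 + 15) ?out (ys @ [y])) (m', t', ?out)"
      proof (rule less.hyps[OF _ m'(1-3) _ _ m'(6)])
        show "2 ^ n - length (ys @ [y]) < 2 ^ n - length ys" using short by simp
        show "26 + n \<le> h + 6" using less.prems(4) by simp
        show "h + 6 + 6 * length (ts' @ us @ vs) \<le> 26 + n + 12 * length (ys @ [y])"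
          using a m'(4,5) by (simp add: a_def)
        show "covered (ys @ [y]) (ts' @ us @ vs)"
          using covered_step[of ys y p q ts' us vs] less.prems(7) m'(7-9) unfolding Cons T by blast
        \<comment> \<open>Between the output at \<open>t + 16\<close> and the next arrival at the
          loop head there are only eight copies and two checks.\<close>
        show "t' \<le> t + 1 + 15 + loop_time" using t' by (simp add: loop_time_def)
      qed
      \<comment> \<open>The new output comes 16 units after the arrival at the loop head, thus at
        most \<open>loop_time + 16\<close> units after \<open>s\<close>; the 50 in the delay bound
        covers this.\<close>
      then show "run (dichotomic_loop A) (?post s out ys) (m', t', ?out)"
      proof (rule wp_mono, clarify)
        fix m'' t'' os zs
        assume "map snd os = map (\<lambda>(a, b). [a, b]) zs" "distinct ((ys @ [y]) @ zs)"
          "emb ` set ((ys @ [y]) @ zs) = nondominated_extreme_points I"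
          "successively (\<lambda>a b. b \<le> a + (loop_time + 50)) ((t + 1 + 15) # map fst os @ [t''])"
        then show "\<exists>os' zs'. ?out @ os = out @ os' \<and>
          map snd os' = map (\<lambda>(a, b). [a, b]) zs' \<and> distinct (ys @ zs') \<and>
          emb ` set (ys @ zs') = nondominated_extreme_points I \<and>
          successively (\<lambda>a b. b \<le> a + (loop_time + 50)) (s # map fst os' @ [t''])"
          using less.prems(8)
          by (intro exI[of _ "(t + 1 + 15, [fst y, snd y]) # os"] exI[of _ "y # zs"])
            (auto simp: case_prod_unfold)
      qed
    qed
  qed
qed

section \<open>The two initial points and the complete run\<close>

lemma endpoints_enclose:
  assumes opt: "lex_ws_optimal I (1, 0) x0" "lex_ws_optimal I (0, 1) x1"
    and e: "e extreme_point_of upper_image I"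
  shows "e = emb (point I x0) \<or> e = emb (point I x1) \<or> between (emb (point I x0)) (emb (point I x1)) e"
proof -
  interpret upper_convex "upper_image I" by (rule upper_convex_upper_image)
  have U: "e \<in> upper_image I" "emb (point I x0) \<in> upper_image I" "emb (point I x1) \<in> upper_image I"
    using e opt emb_point_in_upper_image[OF valid] by (auto simp: extreme_point_of_def lex_ws_optimal_def)
  have 0: "fst (emb (point I x0)) < fst e \<or> fst (emb (point I x0)) = fst e \<and> snd (emb (point I x0)) \<le> snd e"
    using lex_ws_optimal_upper_image[OF valid opt(1) _ _ U(1)] by auto
  have 1: "snd (emb (point I x1)) \<le> snd e"
    using lex_ws_optimal_upper_image[OF valid opt(2) _ _ U(1)] by auto
  \<comment> \<open>The first end is leftmost and the second is lowest. An extreme point that is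
    level with the leftmost one, or not to the left of the lowest one, is weakly dominated by that
    end and equals it by \<open>extreme_le_eq\<close>.\<close>
  show ?thesis
    using extreme_le_eq[OF e U(2)] extreme_le_eq[OF e U(3)] 0 1
    unfolding between_def by (smt (verit))
qed

lemma run_dichotomic_approach:
  "run (dichotomic_approach A) (\<lambda>(m', t', out'). \<exists>zs.
    map snd out' = map (\<lambda>(a, b). [a, b]) zs \<and> distinct zs \<and>
    emb ` set zs = nondominated_extreme_points I \<and>
    successively (\<lambda>a b. b \<le> a + (loop_time + 50)) (0 # map fst out' @ [t'])) (\<lambda>_. 0, 0, [])"
  (is "run _ ?Q _")
proof -
  have small: "bits 0 \<le> w" "bits 1 \<le> w" "bits 26 \<le> w" "bits (of_nat n) \<le> w" "bits (of_nat n + 1) \<le> w"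
    "bits (26 + of_nat n) \<le> w"
    using bits_small[of 0] bits_small[of 1] bits_small[of 26] bits_small[of n] bits_small[of "n + 1"]
      bits_small[of "26 + n"] by (simp_all add: add.commute)
  have weights: "bits 0 \<le> 3 * input_size I + 20" "bits 1 \<le> 3 * input_size I + 20"
    using bits_of_nat_le[of 0 1] bits_of_nat_le[of 1 1] by simp_all
  define m0 :: memory where "m0 = (\<lambda>_. 0)(0 := 0, 1 := 1, 2 := of_nat n, 3 := of_nat n + 1, 12 := 26,
    13 := 26 + of_nat n, 14 := 26 + of_nat n, 4 := 1, 5 := 0)"
  have c0: "constants m0" by (simp add: m0_def constants_def)
  let ?rest = "If (Conj (Equal P1 Q1) (Equal P2 Q2)) Skip (Emit Q1 2 ;; check_pair A ;; dichotomic_loop A)"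
  let ?main = "If (Equal FLAG ZERO)
       Skip
      (compute_point ;; Copy P1 Y1 ;; Copy P2 Y2 ;;
       Const L1 0 ;; Const L2 1 ;; solve_lex A ;;
       compute_point ;; Copy Q1 Y1 ;; Copy Q2 Y2 ;;
       Emit P1 2 ;; ?rest)"
  have "run (solve_lex A) (run ?main ?Q) (m0, 9, [])"
  proof (rule run_solve_lex[OF c0])
    show "0 \<le> m0 4" "0 \<le> m0 5" "bits (m0 4) \<le> 3 * input_size I + 20" "bits (m0 5) \<le> 3 * input_size I + 20"
      using weights by (simp_all add: m0_def)
    fix m1 t1 assume t1: "t1 \<le> 9 + n + 4 + d" and f1: "\<forall>i. i < 25 \<or> 26 + n \<le> i \<longrightarrow> m1 i = m0 i"
      and res: "if sols I = {} then m1 25 = 0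
       else m1 25 = 1 \<and> lex_ws_optimal I (m0 4, m0 5) (map (\<lambda>i. m1 (26 + i)) [0..<n])"
    have c1: "constants m1" by (rule constants_cong[OF c0]) (use f1 in auto)
    show "run ?main ?Q (m1, t1, [])"
    proof (cases "sols I = {}")
      case True
      \<comment> \<open>Coefficients over an empty solution set sum to 0 and not to 1, so the upper
        image is empty.\<close>
      then have "nondominated_extreme_points I = {}"
        by (simp add: nondominated_extreme_points_def upper_image_eq extreme_point_of_def)
      moreover have "m1 25 = m1 0" using True res c1 by (simp add: constants_def)
      ultimately show ?thesis
        using t1 by (auto simp: loop_time_def check_time_def intro!: exI[of _ "[]"])
    next
      case False
      define x0 where "x0 = map (\<lambda>i. m1 (26 + i)) [0..<n]"
      have opt0: "lex_ws_optimal I (1, 0) x0" and m1: "m1 25 = 1"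
        using res False by (simp_all add: x0_def m0_def)
      have ext0: "point I x0 \<in> ext" using ext_optimal[OF opt0] by simp
      have "run compute_point (run (Copy P1 Y1 ;; Copy P2 Y2 ;;
         Const L1 0 ;; Const L2 1 ;; solve_lex A ;;
         compute_point ;; Copy Q1 Y1 ;; Copy Q2 Y2 ;;
         Emit P1 2 ;; ?rest) ?Q) (m1, t1 + 1, [])"
      proof (rule run_compute_point[OF c1, where x = x0])
        show "x0 \<in> sols I" using opt0 by (simp add: lex_ws_optimal_def)
        show "\<forall>i<n. m1 (26 + i) = x0 ! i" by (simp add: x0_def)
        fix m2 t2 assume t2: "t2 \<le> t1 + 1 + 12 * n + 4" and y0: "m2 6 = obj1 I x0" "m2 7 = obj2 I x0"
          and f2: "\<forall>i. i < 6 \<or> 11 < i \<longrightarrow> m2 i = m1 i"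
        define m3 where "m3 = m2(15 := obj1 I x0, 16 := obj2 I x0, 4 := 0, 5 := 1)"
        have c3: "constants m3" by (rule constants_cong[OF c1]) (auto simp: m3_def f2)
        have "run (solve_lex A) (run compute_point (run (Copy Q1 Y1 ;; Copy Q2 Y2 ;; Emit P1 2 ;; ?rest) ?Q))
            (m3, t2 + 4, [])"
        proof (rule run_solve_point[OF c3])
          show "0 \<le> m3 4" "0 \<le> m3 5" "bits (m3 4) \<le> 3 * input_size I + 20"
            "bits (m3 5) \<le> 3 * input_size I + 20"
            using weights by (simp_all add: m3_def)
          show "sols I \<noteq> {}" by (rule False)
          fix m4 t4 x1 assume t4: "t4 \<le> t2 + 4 + 13 * n + 8 + d" and y1: "m4 6 = obj1 I x1" "m4 7 = obj2 I x1"
            and "lex_ws_optimal I (m3 4, m3 5) x1"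
            and f4: "\<forall>i. i < 6 \<or> 11 < i \<and> i < 25 \<or> 26 + n \<le> i \<longrightarrow> m4 i = m3 i"
          then have opt1: "lex_ws_optimal I (0, 1) x1" by (simp add: m3_def)
          then have ext1: "point I x1 \<in> ext" using ext_optimal by simp
          define m5 where "m5 = m4(17 := obj1 I x1, 18 := obj2 I x1)"
          have c5: "constants m5" by (rule constants_cong[OF c3]) (auto simp: m5_def f4)
          have P: "m5 15 = obj1 I x0" "m5 16 = obj2 I x0" and R: "m5 17 = obj1 I x1" "m5 18 = obj2 I x1"
            using f4 by (simp_all add: m5_def m3_def)
          have ends: "m5 13 = of_nat (26 + n)" "m5 14 = of_nat (26 + n)"
            using f4 f2 f1 by (simp_all add: m5_def m3_def m0_def)
          \<comment> \<open>The first output follows two calls and two evaluations, which fit into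
            the bound for the two checks of an iteration.\<close>
          have t5: "t4 + 5 \<le> loop_time" using t1 t2 t4 by (simp add: loop_time_def check_time_def)
          let ?out = "[(t4 + 5, [obj1 I x0, obj2 I x0])]"
          have "run ?rest ?Q (m5, t4 + 5, ?out)"
          proof (cases "point I x0 = point I x1")
            case True
            \<comment> \<open>Nothing lies strictly between a point and itself, so
              \<open>endpoints_enclose\<close> leaves only this point.\<close>
            have "e = emb (point I x0)" if "e extreme_point_of upper_image I" for e
              using endpoints_enclose[OF opt0 opt1 that] True by (auto simp: between_def)
            then have "nondominated_extreme_points I = {emb (point I x0)}"
              using ext0 unfolding nondominated_extreme_points_def ext_def by blast
            then have "?Q (m5, t4 + 5 + 1 + 1, ?out)"
              unfolding prod.case using t5 by (intro exI[of _ "[point I x0]"]) (simp add: point_def)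
            moreover have "holds (Conj (Equal P1 Q1) (Equal P2 Q2)) m5"
              using True by (simp add: P R point_def)
            ultimately show ?thesis by (simp only: wp_simps if_True)
          next
            case False
            let ?out2 = "?out @ [(t4 + 9, [obj1 I x1, obj2 I x1])]"
            have "run (check_pair A) (run (dichotomic_loop A) ?Q) (m5, t4 + 9, ?out2)"
            proof (rule run_check_pair[OF c5 _ _ ends(2) _ _ ext0 ext1 False])
              show "(m5 15, m5 16) = point I x0" "(m5 17, m5 18) = point I x1"
                by (simp_all add: P R point_def)
              show "26 + n + 6 < 2 ^ (n + 6)" using less_exp[of n] by (intro address_bound) linarith
              fix m6 t6 ts assume t6: "t6 \<le> t4 + 9 + check_time"
                and f6: "\<forall>i. i < 4 \<or> i = 12 \<or> i = 13 \<or> 15 \<le> i \<and> i < 25 \<or> 26 + n \<le> i \<and> i < 26 + n \<longrightarrow>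
                  m6 i = m5 i"
                and ts: "length ts \<le> 1" "m6 14 = of_nat (26 + n + 6 * length ts)" "queue_at m6 (26 + n) ts"
                  "\<forall>T\<in>set ts. good T"
                  "\<forall>e. e extreme_point_of upper_image I \<longrightarrow> length (filter (inside e) ts) =
                    (if between (emb (point I x0)) (emb (point I x1)) e then 1 else 0)"
              \<comment> \<open>An extreme point is one of the two ends, already output, or lies
                between them and is then inside the triple queued by the first check.\<close>
              have cov: "covered [point I x0, point I x1] ts"
                unfolding covered_def
              proof (intro conjI allI impI)
                fix e assume e: "e extreme_point_of upper_image I"
                show "count_list (map emb [point I x0, point I x1]) e + length (filter (inside e) ts) = 1"
                  using endpoints_enclose[OF opt0 opt1 e] ts(5)[rule_format, OF e] False
                  by (auto simp: between_def)
              qed (use ext0 ext1 ts(4) in auto)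
              have "run (dichotomic_loop A) (\<lambda>(m', t', out'). \<exists>os zs. out' = ?out2 @ os \<and>
                map snd os = map (\<lambda>(a, b). [a, b]) zs \<and> distinct ([point I x0, point I x1] @ zs) \<and>
                emb ` set ([point I x0, point I x1] @ zs) = nondominated_extreme_points I \<and>
                successively (\<lambda>a b. b \<le> a + (loop_time + 50)) ((t4 + 9) # map fst os @ [t'])) (m6, t6, ?out2)"
              proof (rule run_loop[OF _ _ ts(2) _ _ ts(3) cov])
                show "constants m6" by (rule constants_cong[OF c5]) (auto simp: f6)
                show "m6 13 = of_nat (26 + n)" using f6 ends by simp
                show "t6 \<le> t4 + 9 + loop_time" using t6 by (simp add: loop_time_def)
              qed (use ts(1) in simp_all)
              then show "run (dichotomic_loop A) ?Q (m6, t6, ?out2)"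
              proof (rule wp_mono, clarify)
                fix m7 t7 os zs
                assume "map snd os = map (\<lambda>(a, b). [a, b]) zs" "distinct ([point I x0, point I x1] @ zs)"
                  "emb ` set ([point I x0, point I x1] @ zs) = nondominated_extreme_points I"
                  "successively (\<lambda>a b. b \<le> a + (loop_time + 50)) ((t4 + 9) # map fst os @ [t7])"
                then show "\<exists>zs'. map snd (?out2 @ os) = map (\<lambda>(a, b). [a, b]) zs' \<and> distinct zs' \<and>
                    emb ` set zs' = nondominated_extreme_points I \<and>
                    successively (\<lambda>a b. b \<le> a + (loop_time + 50)) (0 # map fst (?out2 @ os) @ [t7])"
                  using t5 by (intro exI[of _ "[point I x0, point I x1] @ zs"])
                    (simp add: point_def)
              qed
            qed simp
            moreover have "\<not> (obj1 I x0 = obj1 I x1 \<and> obj2 I x0 = obj2 I x1)"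
              using False by (simp add: point_def)
            moreover have "map m5 [17..<19] = [obj1 I x1, obj2 I x1]" by (simp add: upt_rec R)
            ultimately show ?thesis by (simp add: P R Suc_collapse del: add_2_eq_Suc add_2_eq_Suc') blast
          qed
          moreover have "map m5 [15..<17] = [obj1 I x0, obj2 I x0]" by (simp add: upt_rec P)
          ultimately show "run (Copy Q1 Y1 ;; Copy Q2 Y2 ;; Emit P1 2 ;; ?rest) ?Q (m4, t4, [])"
            by (simp add: m5_def y1 Suc_collapse del: add_2_eq_Suc add_2_eq_Suc' wp_simps(9))
        qed
        then show "run (Copy P1 Y1 ;; Copy P2 Y2 ;;
           Const L1 0 ;; Const L2 1 ;; solve_lex A ;;
           compute_point ;; Copy Q1 Y1 ;; Copy Q2 Y2 ;;
           Emit P1 2 ;; ?rest) ?Q (m2, t2, [])"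
          using small y0 by (simp add: m3_def Suc_collapse del: add_2_eq_Suc add_2_eq_Suc')
      qed
      moreover have "\<not> holds (Equal FLAG ZERO) m1" using m1 c1 by (simp add: constants_def)
      ultimately show ?thesis by simp
    qed
  qed
  then show ?thesis
    unfolding dichotomic_approach_def
    using small input_of_simps(1) by (simp add: m0_def Suc_collapse del: add_2_eq_Suc add_2_eq_Suc')
qed

end

section \<open>From numbers for one instance to polynomials in the input size\<close>

lemma poly_nat_mono: "a \<le> b \<Longrightarrow> poly p a \<le> poly p (b :: nat)"
  by (induction p) (auto intro!: add_mono mult_mono)

lemma delay_le_if_successively:
  assumes "successively (\<lambda>a b. b \<le> a + d) (0 # map fst out @ [t])"
  shows "delay_le d out t"
  using assms unfolding delay_le_def Let_def successively_conv_nth by auto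

theorem corollary5p10:
  fixes P :: "boco_instance set" and A :: com
  assumes "boco_problem P"
    and "solves_lex_in_poly_time A P"
  shows "enumerates_with_poly_delay (dichotomic_approach A) P"
proof -
  obtain p q :: "nat poly" where pq: "\<And>I l1 l2. I \<in> P \<Longrightarrow> 0 \<le> l1 \<Longrightarrow> 0 \<le> l2 \<Longrightarrow>
    \<exists>m t out. exec (poly q (input_size I + bits l1 + bits l2)) (input_of I) A
        ((\<lambda>_. 0)(0 := l1, 1 := l2), 0, []) (m, t, out) \<and>
      t \<le> poly p (input_size I + bits l1 + bits l2) \<and>
      (if sols I = {} then m 0 = 0
       else m 0 = 1 \<and> lex_ws_optimal I (l1, l2) (map m [1..<dim I + 1]))"
    using assms(2) unfolding solves_lex_in_poly_time_def Let_def by blast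
  \<comment> \<open>An instance of size \<open>S\<close> with two weights of at most
    \<open>3 * S + 20\<close> bits makes a call of size at most \<open>7 * S + 40\<close>. The
    second summand is the cell length that \<open>dichotomic_run\<close> demands.\<close>
  define W where "W = pcompose q [:40, 7:] + [:20, 3:]"
  \<comment> \<open>With \<open>d\<close> the time bound of a call, \<open>loop_time + 50\<close> is
    \<open>2 * d + 26 * n + 154\<close>, and \<open>n\<close> is at most the input size.\<close>
  define D where "D = smult 2 (pcompose p [:40, 7:]) + [:154, 26:]"
  show ?thesis
    unfolding enumerates_with_poly_delay_def
  proof (rule exI[of _ D], rule exI[of _ W], rule ballI)
    fix I assume I: "I \<in> P"
    let ?s = "input_size I"
    interpret dichotomic_run I A "poly W ?s" "poly p (40 + 7 * ?s)"
    proof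
      show "valid_instance I" using assms(1) I by (simp add: boco_problem_def)
      show "3 * ?s + 20 \<le> poly W ?s" by (simp add: W_def poly_pcompose)
      fix l1 l2 :: rat
      assume l: "0 \<le> l1" "0 \<le> l2" "bits l1 \<le> 3 * ?s + 20" "bits l2 \<le> 3 * ?s + 20"
      then have size: "?s + bits l1 + bits l2 \<le> 40 + 7 * ?s" by simp
      have "poly q (?s + bits l1 + bits l2) \<le> poly W ?s"
        using poly_nat_mono[OF size, of q] by (simp add: W_def poly_pcompose mult.commute)
      then show "\<exists>m t out. exec (poly W ?s) (input_of I) A ((\<lambda>_. 0)(0 := l1, 1 := l2), 0, []) (m, t, out) \<and>
          t \<le> poly p (40 + 7 * ?s) \<and>
          (if sols I = {} then m 0 = 0
           else m 0 = 1 \<and> lex_ws_optimal I (l1, l2) (map m [1..<dim I + 1]))"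
        using pq[OF I l(1,2)] poly_nat_mono[OF size, of p] exec_mono_word_length order_trans by meson
    qed
    have D: "loop_time + 50 \<le> poly D ?s"
      unfolding loop_time_def check_time_def
      using dim_le_input_size by (simp add: D_def poly_pcompose mult.commute)
    obtain m t out ys where
      ex: "exec (poly W ?s) (input_of I) (dichotomic_approach A) (\<lambda>_. 0, 0, []) (m, t, out)" and
      ys: "map snd out = map (\<lambda>(a, b). [a, b]) ys" "distinct ys"
        "emb ` set ys = nondominated_extreme_points I" and
      delay: "successively (\<lambda>a b. b \<le> a + (loop_time + 50)) (0 # map fst out @ [t])"
      using run_dichotomic_approach unfolding wp_def by auto
    have "successively (\<lambda>a b. b \<le> a + poly D ?s) (0 # map fst out @ [t])"
      using D by (intro successively_mono[OF delay]) auto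
    then have "delay_le (poly D ?s) out t" by (rule delay_le_if_successively)
    moreover have "(\<lambda>(y1, y2). (of_rat y1, of_rat y2)) ` set ys = nondominated_extreme_points I"
      using ys(3) by (simp add: emb_def[abs_def] case_prod_unfold)
    ultimately show "\<exists>m t out ys. exec (poly W ?s) (input_of I) (dichotomic_approach A) (\<lambda>_. 0, 0, []) (m, t, out) \<and>
        map snd out = map (\<lambda>(y1, y2). [y1, y2]) ys \<and> distinct ys \<and>
        (\<lambda>(y1, y2). (of_rat y1, of_rat y2)) ` set ys = nondominated_extreme_points I \<and>
        delay_le (poly D ?s) out t"
      using ex ys(1,2) by blast
  qed
qed

end
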